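(* For any basic sequence $(e_n)_n$ in a Banach space, there is a subsequence $(x_n)_n$ of $(e_n)_n$ which satisfies one of the following properties: (i) for any subsequence $(y_n)_n$ of $(x_n)_n$ there is a sequence of successive intervals $(I_n)_n$ of $\mathbb{N}$ such that for every infinite $A\subseteq\mathbb{N}$, $(y_n)_n$ is signed permutatively equivalent to no subsequence of $(x_n)_n$ with indices in $\mathbb{N}\setminus\bigcup_{i\in A}I_i$; (ii) $(x_n)_n$ is signed equivalent to a spreading sequence.
   Context: Two basic sequences $(x_n)_n,(y_n)_n$ are equivalent, $(x_n)_n\sim(y_n)_n$, if there is $K\ge1$ with $\frac1K\|\sum_{n\le k}a_nx_n\|\le\|\sum_{n\le k}a_ny_n\|\le K\|\sum_{n\le k}a_nx_n\|$ for all $k$ and all scalars $a_0,\dots,a_k$. They are permutatively equivalent if $(x_n)_n\sim(y_{\sigma(n)})_n$ for some permutation $\sigma$ of $\mathbb{N}$. $(x_n)_n$ is signed equivalent to $(y_n)_n$ if $(x_n)_n\sim(\epsilon_ny_n)_n$ for some $(\epsilon_n)_n\in\{-1,1\}^\omega$; $(x_n)_n$ is signed permutatively equivalent to $(y_n)_n$ if it is permutatively equivalent to $(\epsilon_ny_n)_n$ for some $(\epsilon_n)_n\in\{-1,1\}^\omega$. A basic sequence (in some Banach space) is spreading if it is equivalent to all of its subsequences. Intervals are sets $[a,b]\cap\mathbb{N}$ with $0\le a<b$; a sequence of intervals is successive if $\max I_n<\min I_{n+1}$ for all $n$. *)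

theory Defs
  imports "HOL-Analysis.Analysis"
begin

section \<open>Banach spaces over the real or complex field\<close>

text \<open>
  The library class of Banach spaces only has real scalars.  In order to cover real and complex
  spaces alike, the scalar multiplication \<open>scl\<close> is a parameter.  By the theorem of Mazur, up to
  isomorphism the only instances of class \<open>real_normed_field\<close> are the real and the complex numbers.
\<close>

locale banach_over = vector_space scl
  for scl :: "'k::real_normed_field \<Rightarrow> 'a::banach \<Rightarrow> 'a" +
  assumes norm_scl: "norm (scl c x) = norm c * norm x"
    and scl_of_real: "scl (of_real r) x = r *\<^sub>R x"

lemma banach_over_scaleR: "banach_over (scaleR :: real \<Rightarrow> 'a::banach \<Rightarrow> 'a)"
  by unfold_locales (auto simp: algebra_simps)

lemma banach_over_complex: "banach_over ((*) :: complex \<Rightarrow> complex \<Rightarrow> complex)"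
  by unfold_locales (auto simp: algebra_simps norm_mult scaleR_conv_of_real)

section \<open>Basic sequences and their equivalences\<close>

text \<open>A basic sequence is a Schauder basis of its closed linear span.\<close>

definition basic_sequence ::
    "('k::real_normed_field \<Rightarrow> 'a::banach \<Rightarrow> 'a) \<Rightarrow> (nat \<Rightarrow> 'a) \<Rightarrow> bool" where
  "basic_sequence scl e \<longleftrightarrow>
     (\<forall>v \<in> closure (module.span scl (range e)). \<exists>!a. (\<lambda>n. scl (a n) (e n)) sums v)"

definition seq_equivalent ::
    "('k::real_normed_field \<Rightarrow> 'a::banach \<Rightarrow> 'a) \<Rightarrow> (nat \<Rightarrow> 'a) \<Rightarrow> (nat \<Rightarrow> 'a) \<Rightarrow> bool" where
  "seq_equivalent scl x y \<longleftrightarrow>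
     (\<exists>K::real. K \<ge> 1 \<and>
        (\<forall>(k::nat) (a :: nat \<Rightarrow> 'k).
           1 / K * norm (\<Sum>n\<le>k. scl (a n) (x n)) \<le> norm (\<Sum>n\<le>k. scl (a n) (y n)) \<and>
           norm (\<Sum>n\<le>k. scl (a n) (y n)) \<le> K * norm (\<Sum>n\<le>k. scl (a n) (x n))))"

definition perm_equivalent ::
    "('k::real_normed_field \<Rightarrow> 'a::banach \<Rightarrow> 'a) \<Rightarrow> (nat \<Rightarrow> 'a) \<Rightarrow> (nat \<Rightarrow> 'a) \<Rightarrow> bool" where
  "perm_equivalent scl x y \<longleftrightarrow> (\<exists>\<sigma>::nat \<Rightarrow> nat. bij \<sigma> \<and> seq_equivalent scl x (\<lambda>n. y (\<sigma> n)))"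

text \<open>
  Both sequences live in the same space.  This loses nothing when one asks for a spreading sequence to
  which \<open>x\<close> is signed equivalent: since the signs can be moved to the coefficients, such a sequence in
  any other space is equivalent to a sequence of the form \<open>\<epsilon> n x n\<close>, which is then spreading as well.
\<close>

definition signed_equivalent ::
    "('k::real_normed_field \<Rightarrow> 'a::banach \<Rightarrow> 'a) \<Rightarrow> (nat \<Rightarrow> 'a) \<Rightarrow> (nat \<Rightarrow> 'a) \<Rightarrow> bool" where
  "signed_equivalent scl x y \<longleftrightarrow>
     (\<exists>\<epsilon>::nat \<Rightarrow> 'k. (\<forall>n. \<epsilon> n \<in> {-1, 1}) \<and> seq_equivalent scl x (\<lambda>n. scl (\<epsilon> n) (y n)))"

definition signed_perm_equivalent ::
    "('k::real_normed_field \<Rightarrow> 'a::banach \<Rightarrow> 'a) \<Rightarrow> (nat \<Rightarrow> 'a) \<Rightarrow> (nat \<Rightarrow> 'a) \<Rightarrow> bool" where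
  "signed_perm_equivalent scl x y \<longleftrightarrow>
     (\<exists>\<epsilon>::nat \<Rightarrow> 'k. (\<forall>n. \<epsilon> n \<in> {-1, 1}) \<and> perm_equivalent scl x (\<lambda>n. scl (\<epsilon> n) (y n)))"

definition subsequence_of :: "(nat \<Rightarrow> 'a) \<Rightarrow> (nat \<Rightarrow> 'a) \<Rightarrow> bool" where
  "subsequence_of y x \<longleftrightarrow> (\<exists>r::nat \<Rightarrow> nat. strict_mono r \<and> y = x \<circ> r)"

definition subsequence_with_indices_in :: "nat set \<Rightarrow> (nat \<Rightarrow> 'a) \<Rightarrow> (nat \<Rightarrow> 'a) \<Rightarrow> bool" where
  "subsequence_with_indices_in B z x \<longleftrightarrow>
     (\<exists>r::nat \<Rightarrow> nat. strict_mono r \<and> range r \<subseteq> B \<and> z = x \<circ> r)"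

definition spreading ::
    "('k::real_normed_field \<Rightarrow> 'a::banach \<Rightarrow> 'a) \<Rightarrow> (nat \<Rightarrow> 'a) \<Rightarrow> bool" where
  "spreading scl x \<longleftrightarrow>
     basic_sequence scl x \<and> (\<forall>y. subsequence_of y x \<longrightarrow> seq_equivalent scl x y)"

section \<open>Successive intervals\<close>

definition nat_interval :: "nat set \<Rightarrow> bool" where
  "nat_interval I \<longleftrightarrow> (\<exists>a b. a < b \<and> I = {a..b})"

definition successive_intervals :: "(nat \<Rightarrow> nat set) \<Rightarrow> bool" where
  "successive_intervals I \<longleftrightarrow>
     (\<forall>n. nat_interval (I n)) \<and> (\<forall>n. Max (I n) < Min (I (Suc n)))"

end

theory Submission
  imports Defs "HOL-Computational_Algebra.Fundamental_Theorem_Algebra"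
    "HOL-Library.Ramsey" "HOL-Library.Diagonal_Subsequence"
begin

text \<open>
  By Ramsey's theorem, \<open>e\<close> has a subsequence \<open>x\<close> such that for all \<open>n\<close> and \<open>M\<close>, either any two
  successive blocks of \<open>n\<close> terms far enough out in \<open>x\<close> are \<open>M\<close>-equivalent, or no two are.
  Suppose that (i) fails for \<open>x\<close>, witnessed by \<open>y\<close>.  Choosing the intervals \<open>I n\<close> one after the other,
  with constants tending to infinity, one finds \<open>K\<close> and \<open>m0\<close> such that for every \<open>m\<close> the sequence \<open>y\<close> is
  \<open>K\<close>-equivalent to signed terms of \<open>x\<close>, in some order, whose indices \<open>p m i\<close> avoid the interval from
  \<open>m0\<close> to \<open>m\<close>.  Ramsey's theorem for the triples \<open>i < j < m\<close> yields a subsequence of \<open>y\<close> along which the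
  signs are constant and \<open>p m\<close> is monotone with values above \<open>m\<close>; so its initial segments are
  \<open>K\<close>-equivalent to blocks of \<open>x\<close> (possibly reversed) arbitrarily far out.  Hence the first alternative
  of the stabilization holds with \<open>M\<close> independent of \<open>n\<close>, and this subsequence of \<open>y\<close> is spreading.

  That a subsequence of a basic sequence is basic rests on the continuity of the coordinate
  functionals (Baire category), which needs complete scalars; completeness comes from an
  elementary proof of the Gelfand--Mazur theorem.
\<close>

section \<open>Completeness of the scalar field\<close>

abbreviation real_poly_at :: "real poly \<Rightarrow> 'k::real_normed_field \<Rightarrow> 'k" where
  "real_poly_at p z \<equiv> poly (map_poly of_real p) z"

lemma real_poly_at_add:
  fixes z :: "'k::real_normed_field"
  shows "real_poly_at (p + q) z = real_poly_at p z + real_poly_at q z"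
proof -
  have "map_poly of_real (p + q) = (map_poly of_real p + map_poly of_real q :: 'k poly)"
    by (simp add: poly_eq_iff coeff_map_poly)
  then show ?thesis
    by simp
qed

lemma real_poly_at_diff:
  fixes z :: "'k::real_normed_field"
  shows "real_poly_at (p - q) z = real_poly_at p z - real_poly_at q z"
  using real_poly_at_add[of "p - q" q z] by (simp add: algebra_simps)

lemma real_poly_at_mult: "real_poly_at (p * q) z = real_poly_at p z * real_poly_at q z"
proof (induction p)
  case (pCons a p)
  have "real_poly_at (smult a q) z = of_real a * real_poly_at q z"
    by (simp add: map_poly_smult)
  then show ?case
    using pCons by (simp add: real_poly_at_add map_poly_pCons algebra_simps)
qed simp

lemma real_poly_at_power: "real_poly_at (p ^ n) z = real_poly_at p z ^ n"
  by (induction n) (simp_all add: real_poly_at_mult)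

lemma real_poly_at_of_real: "real_poly_at p (of_real r) = of_real (poly p r)"
  by (induction p) (simp_all add: map_poly_pCons)

text \<open>
  The norm of \<open>(z - c) * (z - cnj c)\<close>; the expanded form makes sense even if \<open>'k\<close> does not contain the
  complex numbers.
\<close>

definition norm_quad :: "'k::real_normed_field \<Rightarrow> complex \<Rightarrow> real" where
  "norm_quad z c = norm (z\<^sup>2 - of_real (2 * Re c) * z + of_real ((norm c)\<^sup>2))"

lemma norm_quad_real_poly_at:
  "norm_quad z c = norm (real_poly_at [:(norm c)\<^sup>2, - 2 * Re c, 1:] z)"
  by (simp add: norm_quad_def map_poly_pCons power2_eq_square algebra_simps)

text \<open>The remainder modulo the quadratic is \<open>a + b * X\<close> with real
  \<open>a\<close> and \<open>b\<close>. Its root \<open>c\<close> is not real, so imaginary parts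
  give \<open>b = 0\<close>, and then \<open>a = 0\<close>.\<close>

lemma quad_dvd_real_poly:
  fixes g :: "real poly" and c :: complex
  assumes "real_poly_at g c = 0" and "Im c \<noteq> 0"
  shows "[:(norm c)\<^sup>2, - 2 * Re c, 1:] dvd g"
proof -
  let ?q = "[:(norm c)\<^sup>2, - 2 * Re c, 1:]"
  have "degree (g mod ?q) < 2"
    using degree_mod_less[of ?q g] by auto
  then obtain a b where ab: "g mod ?q = [:a, b:]"
    by (metis One_nat_def Suc_1 degree1_coeffs less_2_cases_iff degree_eq_zeroE pCons_0_0 less_Suc_eq_le
        le_eq_less_or_eq)
  have q: "real_poly_at ?q c = 0"
    by (simp add: map_poly_pCons complex_eq_iff cmod_power2) (simp add: power2_eq_square algebra_simps)
  have "real_poly_at g c = real_poly_at (?q * (g div ?q) + g mod ?q) c"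
    by (metis mult_div_mod_eq)
  also have "\<dots> = of_real a + of_real b * c"
    unfolding real_poly_at_add real_poly_at_mult q ab by (simp add: map_poly_pCons)
  finally have "of_real a + of_real b * c = 0"
    using assms by simp
  then have "b = 0 \<and> a = 0"
    using assms(2) by (auto simp: complex_eq_iff)
  then show ?thesis
    using ab by (simp add: dvd_eq_mod_eq_0)
qed

text \<open>Induction by splitting off a real monic factor of degree 1 or 2. At \<open>z\<close>, a
  factor \<open>X - r\<close> has squared norm \<open>norm_quad z (of_real r)\<close>, hence at
  least \<open>m\<close>, and a quadratic factor has norm at least \<open>m\<close>. After squaring,
  each degree contributes one factor \<open>m\<close> in both cases.\<close>

lemma norm_monic_real_poly_ge:
  fixes z :: "'k::real_normed_field"
  assumes m: "\<And>c. m \<le> norm_quad z c" and "0 \<le> m"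
  shows "lead_coeff g = 1 \<Longrightarrow> m ^ degree g \<le> (norm (real_poly_at g z))\<^sup>2"
proof (induction "degree g" arbitrary: g rule: less_induct)
  case less
  show ?case
  proof (cases "degree g = 0")
    case True
    then show ?thesis
      using less.prems by (auto elim!: degree_eq_zeroE simp: map_poly_pCons)
  next
    case False
    then have "\<not> constant (poly (map_poly complex_of_real g))"
      by (simp add: constant_degree degree_map_poly)
    then obtain c :: complex where c: "real_poly_at g c = 0"
      using fundamental_theorem_of_algebra by blast
    obtain q h where q: "g = q * h" "lead_coeff q = 1" "0 < degree q"
      "m ^ degree q \<le> (norm (real_poly_at q z))\<^sup>2"
    proof (cases "Im c = 0")
      case True
      define r where "r = Re c"
      have "c = of_real r"
        using True by (simp add: r_def complex_eq_iff)
      then have "of_real (poly g r) = (0::complex)"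
        using c real_poly_at_of_real[of g r] by metis
      then obtain h where h: "g = [:- r, 1:] * h"
        by (auto simp: poly_eq_0_iff_dvd)
      have "norm_quad z (of_real r) = (norm (real_poly_at [:- r, 1:] z))\<^sup>2"
        unfolding norm_quad_def
        by (simp add: map_poly_pCons power2_eq_square algebra_simps flip: norm_mult)
      then have "m ^ degree [:- r, 1:] \<le> (norm (real_poly_at [:- r, 1:] z))\<^sup>2"
        using m[of "of_real r"] by simp
      then show ?thesis
        using that[OF h] by simp
    next
      case False
      let ?q = "[:(norm c)\<^sup>2, - 2 * Re c, 1:]"
      obtain h where h: "g = ?q * h"
        using quad_dvd_real_poly[OF c False] by (auto elim: dvdE)
      have "m ^ degree ?q \<le> (norm (real_poly_at ?q z))\<^sup>2"
        using power_mono[OF m[of c] \<open>0 \<le> m\<close>, of 2] by (simp add: norm_quad_real_poly_at numeral_2_eq_2)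
      then show ?thesis
        using that[OF h] by simp
    qed
    have [simp]: "q \<noteq> 0" "h \<noteq> 0"
      using q less.prems by auto
    have "lead_coeff g = lead_coeff q * lead_coeff h"
      by (simp only: q(1) lead_coeff_mult)
    then have "m ^ degree h \<le> (norm (real_poly_at h z))\<^sup>2"
      using q less.prems by (intro less.hyps) (simp_all add: degree_mult_eq)
    then have "m ^ degree q * m ^ degree h \<le> (norm (real_poly_at q z))\<^sup>2 * (norm (real_poly_at h z))\<^sup>2"
      using q \<open>0 \<le> m\<close> by (intro mult_mono) auto
    then show ?thesis
      using q by (simp add: degree_mult_eq power_add real_poly_at_mult norm_mult power_mult_distrib)
  qed
qed

text \<open>
  With \<open>Q\<close> and \<open>Q'\<close> the quadratic polynomials for \<open>c\<close> and \<open>c'\<close>, so that \<open>Q' = Q + m / 2\<close>, the polynomial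
  \<open>Q ^ (n + 1) - (- m / 2) ^ (n + 1)\<close> is \<open>Q'\<close> times a monic polynomial of degree \<open>2 * n\<close>, whose value at \<open>z\<close>
  has norm at least \<open>m ^ n\<close>.  The bound follows as \<open>n\<close> tends to infinity.
  Applied to a minimizer \<open>c\<close> of largest modulus, it shows that a positive minimum is impossible.
\<close>

lemma norm_quad_shift_le:
  fixes z :: "'k::real_normed_field"
  assumes m: "\<And>c. m \<le> norm_quad z c" and "0 < m" and c: "norm_quad z c = m"
    and c': "Re c' = Re c" "(norm c')\<^sup>2 = (norm c)\<^sup>2 + m / 2"
  shows "norm_quad z c' \<le> m"
proof -
  let ?Q = "[:(norm c)\<^sup>2, - 2 * Re c, 1:]" and ?Q' = "[:(norm c')\<^sup>2, - 2 * Re c', 1:]"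
  let ?E = "[:- (m / 2):]"
  have Q': "?Q' = ?Q - ?E"
    by (simp add: c')
  have step: "norm_quad z c' * m ^ n \<le> m ^ Suc n + (m / 2) ^ Suc n" for n
  proof -
    define P where "P = ?Q ^ Suc n - ?E ^ Suc n"
    obtain g where g: "P = ?Q' * g"
      unfolding P_def Q' diff_power_eq_sum by blast
    have Q: "degree (?Q ^ Suc n) = 2 * Suc n" "lead_coeff (?Q ^ Suc n) = 1"
      by (subst degree_power_eq; simp) (subst lead_coeff_power; simp)
    have E: "degree (?E ^ Suc n) = 0"
      using degree_power_le[of ?E "Suc n"] by simp
    have "degree P = degree (?Q ^ Suc n)"
      unfolding P_def diff_conv_add_uminus by (rule degree_add_eq_left) (simp only: degree_minus E Q, simp)
    then have P: "degree P = 2 * Suc n" "lead_coeff P = 1"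
      using Q E by (simp_all only: P_def coeff_diff) (simp add: coeff_eq_0 del: power_Suc)
    then have "g \<noteq> 0" "?Q' \<noteq> 0"
      using g by auto
    then have "degree P = 2 + degree g" "lead_coeff P = lead_coeff g"
      unfolding g by (subst degree_mult_eq; simp) (subst lead_coeff_mult; simp)
    then have "degree g = 2 * n" "lead_coeff g = 1"
      using P by simp_all
    then have "(m ^ n)\<^sup>2 \<le> (norm (real_poly_at g z))\<^sup>2"
      using norm_monic_real_poly_ge[OF m, of g] \<open>0 < m\<close> by (simp add: power_mult mult.commute flip: power_mult)
    then have "m ^ n \<le> norm (real_poly_at g z)"
      using power2_le_imp_le by fastforce
    then have "norm_quad z c' * m ^ n \<le> norm_quad z c' * norm (real_poly_at g z)"
      by (intro mult_left_mono) (simp_all add: norm_quad_def)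
    also have "\<dots> = norm (real_poly_at P z)"
      by (simp only: g real_poly_at_mult norm_mult norm_quad_real_poly_at)
    also have "\<dots> = norm (real_poly_at ?Q z ^ Suc n - of_real (- (m / 2)) ^ Suc n)"
      unfolding P_def real_poly_at_diff real_poly_at_power by (simp add: map_poly_pCons)
    also have "\<dots> \<le> norm (real_poly_at ?Q z) ^ Suc n + norm (of_real (- (m / 2)) :: 'k) ^ Suc n"
      by (metis norm_power norm_triangle_ineq4)
    also have "\<dots> = m ^ Suc n + (m / 2) ^ Suc n"
      using c \<open>0 < m\<close> by (simp add: norm_quad_real_poly_at del: of_real_minus of_real_divide)
    finally show ?thesis .
  qed
  show ?thesis
  proof (rule ccontr)
    assume "\<not> ?thesis"
    then have "0 < (norm_quad z c' - m) / m"
      using \<open>0 < m\<close> by simp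
    then obtain n where n: "(1 / 2) ^ n < (norm_quad z c' - m) / m"
      using real_arch_pow_inv[of _ "1 / 2"] by auto
    have "(norm_quad z c' - m) * m ^ n \<le> m * (1 / 2) ^ Suc n * m ^ n"
      using step[of n] by (simp add: algebra_simps power_divide)
    then have "norm_quad z c' - m \<le> m * (1 / 2) ^ Suc n"
      using \<open>0 < m\<close> by (metis mult_right_le_imp_le zero_less_power)
    also have "\<dots> \<le> m * (1 / 2) ^ n"
      using \<open>0 < m\<close> by simp
    finally show False
      using n \<open>0 < m\<close> by (simp add: field_simps)
  qed
qed

text \<open>The conclusion makes \<open>z\<close> a root of a real quadratic polynomial. Since
  \<open>norm_quad z\<close> is continuous and large outside a disc, its minimum is attained on a
  compact set, which has a point of largest modulus.\<close>

theorem gelfand_mazur_norm_quad: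
  fixes z :: "'k::real_normed_field"
  shows "\<exists>c. norm_quad z c = 0"
proof -
  \<comment> \<open>With this radius, \<open>R * (R - 2 * norm z)\<close> exceeds
    \<open>2 * (norm z)\<^sup>2\<close>. This pushes \<open>norm_quad z c\<close> above
    \<open>norm_quad z 0\<close>, which is \<open>(norm z)\<^sup>2\<close>.\<close>
  define R where "R = 3 * norm z + 1"
  have cont: "continuous_on S (norm_quad z)" for S
    unfolding norm_quad_def by (intro continuous_intros)
  have outside: "norm_quad z 0 < norm_quad z c" if "R \<le> norm c" for c
  proof -
    have "norm (of_real ((norm c)\<^sup>2) :: 'k) \<le> norm_quad z c + norm (z\<^sup>2 - of_real (2 * Re c) * z)"
      unfolding norm_quad_def by (rule order_trans[OF _ norm_triangle_ineq4]) simp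
    also have "norm (z\<^sup>2 - of_real (2 * Re c) * z) \<le> (norm z)\<^sup>2 + 2 * \<bar>Re c\<bar> * norm z"
      by (rule order_trans[OF norm_triangle_ineq4]) (simp add: norm_mult norm_power)
    also have "\<dots> \<le> (norm z)\<^sup>2 + 2 * norm c * norm z"
      by (simp add: abs_Re_le_cmod mult_right_mono)
    finally have *: "(norm c)\<^sup>2 \<le> norm_quad z c + (norm z)\<^sup>2 + 2 * norm c * norm z"
      by (simp add: norm_power)
    have "R * (R - 2 * norm z) \<le> norm c * (norm c - 2 * norm z)"
      using that by (intro mult_mono) (auto simp: R_def)
    moreover have "R * (R - 2 * norm z) = 2 * (norm z)\<^sup>2 + ((norm z)\<^sup>2 + 4 * norm z + 1)"
      by (simp add: R_def power2_eq_square algebra_simps)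
    moreover have "0 < (norm z)\<^sup>2 + 4 * norm z + 1"
      by (intro add_nonneg_pos) auto
    ultimately have "2 * (norm z)\<^sup>2 < (norm c)\<^sup>2 - 2 * norm c * norm z"
      by (simp add: power2_eq_square algebra_simps)
    then show ?thesis
      using * by (simp add: norm_quad_def norm_power)
  qed
  have "0 \<le> R"
    by (simp add: R_def)
  then obtain c1 where c1: "c1 \<in> cball 0 R" "\<And>c. c \<in> cball 0 R \<Longrightarrow> norm_quad z c1 \<le> norm_quad z c"
    using continuous_attains_inf[of "cball 0 R" "norm_quad z"] cont by auto
  define m where "m = norm_quad z c1"
  have m: "m \<le> norm_quad z c" for c
    using c1(2)[of c] c1(2)[of 0] outside[of c] \<open>0 \<le> R\<close> unfolding m_def by (cases "norm c \<le> R") (auto intro: order_trans less_imp_le)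
  define S where "S = cball 0 R \<inter> {c. norm_quad z c = m}"
  have "closed {c. norm_quad z c = m}"
    using cont by (intro closed_Collect_eq) auto
  then have "compact S"
    unfolding S_def by (intro compact_Int_closed) auto
  moreover have "c1 \<in> S"
    using c1 by (simp add: S_def m_def)
  ultimately obtain c0 where c0: "c0 \<in> S" "\<And>c. c \<in> S \<Longrightarrow> norm c \<le> norm c0"
    using continuous_attains_sup[of S norm] by (auto intro: continuous_intros)
  have "m = 0"
  proof (rule ccontr)
    assume "m \<noteq> 0"
    then have "0 < m"
      by (simp add: m_def norm_quad_def)
    \<comment> \<open>Keeping the real part fixes the linear coefficient, and only the constant term
      grows, by \<open>m / 2\<close>. So \<open>c'\<close> will be a minimizer of larger modulus
      than \<open>c0\<close>.\<close>
    define c' where "c' = Complex (Re c0) (sqrt ((Im c0)\<^sup>2 + m / 2))"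
    have c': "Re c' = Re c0" "(norm c')\<^sup>2 = (norm c0)\<^sup>2 + m / 2"
      using \<open>0 < m\<close> by (simp_all add: c'_def cmod_power2)
    have "norm_quad z c' \<le> m"
      using c0 by (intro norm_quad_shift_le[OF m \<open>0 < m\<close> _ c']) (auto simp: S_def)
    then have "norm_quad z c' = m"
      using m by (intro antisym)
    moreover from this have "c' \<in> cball 0 R"
      using outside[of c'] m[of 0] by (cases "R \<le> norm c'") auto
    ultimately have "norm c' \<le> norm c0"
      by (intro c0) (auto simp: S_def)
    then have "(norm c')\<^sup>2 \<le> (norm c0)\<^sup>2"
      by (intro power_mono) auto
    then show False
      using c' \<open>0 < m\<close> by simp
  qed
  then show ?thesis
    unfolding m_def by blast
qed

text \<open>Completing the square in the quadratic equation of \<open>w\<close> gives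
  \<open>(w - a)\<^sup>2 = - b\<^sup>2\<close> with real \<open>a\<close> and \<open>b\<close>. For
  a non-real element \<open>b\<close> is nonzero, and division by it gives a square root
  \<open>i\<close> of \<open>-1\<close>. For any \<open>w\<close>, then, \<open>w - a\<close> and
  \<open>b * i\<close> have equal squares and agree up to sign.\<close>

lemma real_normed_field_cases:
  obtains "\<And>w :: 'k::real_normed_field. w \<in> \<real>"
  | i :: "'k::real_normed_field" where "i\<^sup>2 = - 1" "\<And>w. \<exists>a b. w = of_real a + of_real b * i"
proof (cases "\<forall>w :: 'k. w \<in> \<real>")
  case False
  then obtain z :: 'k where z: "z \<notin> \<real>"
    by blast
  have square: "\<exists>a b. (w - of_real a)\<^sup>2 = - (of_real b)\<^sup>2" for w :: 'k
  proof -
    obtain c where "norm_quad w c = 0"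
      using gelfand_mazur_norm_quad by blast
    then have "w\<^sup>2 - of_real (2 * Re c) * w + of_real ((Re c)\<^sup>2 + (Im c)\<^sup>2) = 0"
      by (simp add: norm_quad_def cmod_power2)
    then have "(w - of_real (Re c))\<^sup>2 = - (of_real (Im c))\<^sup>2"
      by (simp add: power2_eq_square algebra_simps)
    then show ?thesis
      by blast
  qed
  obtain a b where ab: "(z - of_real a)\<^sup>2 = - (of_real b)\<^sup>2"
    using square by blast
  with z have "b \<noteq> 0"
    by auto
  define i where "i = (z - of_real a) / of_real b"
  have i: "i\<^sup>2 = - 1"
    using ab \<open>b \<noteq> 0\<close> by (simp add: i_def power_divide)
  have "\<exists>a b. w = of_real a + of_real b * i" for w
  proof -
    obtain a b where ab: "(w - of_real a)\<^sup>2 = - (of_real b)\<^sup>2"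
      using square by blast
    also have "\<dots> = (of_real b * i)\<^sup>2"
      by (simp add: power_mult_distrib i)
    finally have "w - of_real a = of_real b * i \<or> w - of_real a = of_real (- b) * i"
      by (simp add: power2_eq_iff)
    then show ?thesis
      by (metis add.commute diff_add_cancel)
  qed
  with i that(2) show ?thesis
    by blast
qed (use that in blast)

text \<open>The norm controls the real coordinates, one or two of them, so completeness of the reals
  applies to each.\<close>

theorem real_normed_field_complete:
  fixes X :: "nat \<Rightarrow> 'k::real_normed_field"
  assumes "Cauchy X"
  shows "convergent X"
proof (cases rule: real_normed_field_cases[where 'k = 'k])
  case 1
  have "\<forall>n. \<exists>r. X n = of_real r"
    using 1 by (auto elim: Reals_cases)
  then obtain x where x: "\<And>n. X n = of_real (x n)"
    by metis
  then have "X = (\<lambda>n. of_real (x n))"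
    by blast
  moreover have "Cauchy x"
    using assms unfolding Cauchy_def x dist_of_real .
  ultimately show ?thesis
    by (auto simp: Cauchy_convergent_iff convergent_def intro: tendsto_of_real)
next
  case (2 i)
  \<comment> \<open>The product of \<open>?w\<close> and its conjugate is
    \<open>a\<^sup>2 + b\<^sup>2\<close>, at least half of \<open>?s * ?s\<close>. As the conjugate
    has norm at most \<open>?s\<close>, one factor \<open>?s\<close> can be cancelled.\<close>
  have bound: "\<bar>a\<bar> + \<bar>b\<bar> \<le> 2 * norm (of_real a + of_real b * i)" (is "?s \<le> 2 * norm ?w") for a b
  proof -
    have "norm i ^ 2 = 1"
      by (metis "2"(1) norm_minus_cancel norm_one norm_power)
    then have "norm i = 1"
      by (simp add: power2_eq_1_iff) (metis norm_ge_zero not_one_le_zero neg_0_le_iff_le)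
    have "?w * (of_real a - of_real b * i) = of_real (a\<^sup>2) - of_real (b\<^sup>2) * i\<^sup>2"
      by (simp add: power2_eq_square algebra_simps)
    also have "\<dots> = of_real (a\<^sup>2 + b\<^sup>2)"
      by (simp add: 2)
    finally have "a\<^sup>2 + b\<^sup>2 = norm ?w * norm (of_real a - of_real b * i)"
      by (metis abs_of_nonneg norm_mult norm_of_real sum_power2_ge_zero)
    also have "\<dots> \<le> norm ?w * ?s"
      using norm_triangle_ineq4[of "of_real a" "of_real b * i"]
      by (intro mult_left_mono) (simp_all add: norm_mult \<open>norm i = 1\<close>)
    finally have "a\<^sup>2 + b\<^sup>2 \<le> norm ?w * ?s" .
    moreover have "?s * ?s \<le> 2 * (a\<^sup>2 + b\<^sup>2)"
      using zero_le_power2[of "\<bar>a\<bar> - \<bar>b\<bar>"] by (simp add: power2_eq_square algebra_simps)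
    ultimately have *: "?s * ?s \<le> (2 * norm ?w) * ?s"
      by simp
    show ?thesis
    proof (rule ccontr)
      assume "\<not> ?thesis"
      moreover from this have "0 < ?s"
        using norm_ge_zero[of ?w] by linarith
      ultimately have "(2 * norm ?w) * ?s < ?s * ?s"
        by (intro mult_strict_right_mono) simp_all
      with * show False
        by linarith
    qed
  qed
  have "\<forall>n. \<exists>a b. X n = of_real a + of_real b * i"
    using 2(2) by blast
  then obtain x y where xy: "\<And>n. X n = of_real (x n) + of_real (y n) * i"
    by metis
  have diff: "\<bar>x m - x n\<bar> + \<bar>y m - y n\<bar> \<le> 2 * norm (X m - X n)" for m n
    using bound[of "x m - x n" "y m - y n"] by (simp add: xy algebra_simps)
  have "Cauchy x \<and> Cauchy y"
  proof (intro conjI metric_CauchyI)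
    fix \<epsilon> :: real
    assume "0 < \<epsilon>"
    then obtain M where M: "\<And>m n. m \<ge> M \<Longrightarrow> n \<ge> M \<Longrightarrow> norm (X m - X n) < \<epsilon> / 2"
      using CauchyD[OF assms, of "\<epsilon> / 2"] by auto
    have "dist (x m) (x n) < \<epsilon> \<and> dist (y m) (y n) < \<epsilon>" if "m \<ge> M" "n \<ge> M" for m n
      using M[OF that] diff[of m n] unfolding dist_real_def by linarith
    then show "\<exists>M. \<forall>m\<ge>M. \<forall>n\<ge>M. dist (x m) (x n) < \<epsilon>" "\<exists>M. \<forall>m\<ge>M. \<forall>n\<ge>M. dist (y m) (y n) < \<epsilon>"
      by blast+
  qed
  then obtain a b where "x \<longlonglongrightarrow> a" "y \<longlonglongrightarrow> b"
    by (auto simp: Cauchy_convergent_iff convergent_def)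
  then have "X \<longlonglongrightarrow> of_real a + of_real b * i"
    unfolding xy by (intro tendsto_intros)
  then show ?thesis
    by (rule convergentI)
qed

section \<open>Continuity of coordinate functionals\<close>

context banach_over
begin

lemma bounded_linear_scl: "bounded_linear (scl c)"
proof (rule bounded_linear_intro[where K = "norm c"])
  show "scl c (r *\<^sub>R x) = r *\<^sub>R scl c x" for r x
    by (simp add: mult.commute flip: scl_of_real)
qed (simp_all add: scale_right_distrib norm_scl mult.commute)

lemma tendsto_scl_left:
  assumes "c \<longlonglongrightarrow> d"
  shows "(\<lambda>n. scl (c n) u) \<longlonglongrightarrow> scl d u"
proof -
  have "(\<lambda>n. norm (c n - d) * norm u) \<longlonglongrightarrow> 0"
    using assms by (intro tendsto_mult_left_zero tendsto_norm_zero) (simp add: LIM_zero)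
  then have "(\<lambda>n. norm (scl (c n) u - scl d u)) \<longlonglongrightarrow> 0"
    by (simp only: norm_scl flip: scale_left_diff_distrib)
  then have "(\<lambda>n. scl (c n) u - scl d u) \<longlonglongrightarrow> 0"
    by (rule tendsto_norm_zero_cancel)
  then show ?thesis
    by (rule LIM_zero_cancel)
qed

lemma Cauchy_scl_cancel:
  assumes "Cauchy (\<lambda>n. scl (c n) u)" and "u \<noteq> 0"
  shows "Cauchy c"
proof (rule CauchyI)
  fix \<epsilon> :: real
  assume "0 < \<epsilon>"
  then have "0 < \<epsilon> * norm u"
    using \<open>u \<noteq> 0\<close> by simp
  from CauchyD[OF assms(1) this] show "\<exists>M. \<forall>m\<ge>M. \<forall>n\<ge>M. norm (c m - c n) < \<epsilon>"
    using \<open>u \<noteq> 0\<close> by (simp add: norm_scl flip: scale_left_diff_distrib)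
qed

end

section \<open>Expansions with respect to a basic sequence\<close>

locale basic_seq = banach_over scl
  for scl :: "'k::real_normed_field \<Rightarrow> 'a::banach \<Rightarrow> 'a" +
  fixes e :: "nat \<Rightarrow> 'a"
  assumes basic: "basic_sequence scl e"
begin

definition cspan :: "'a set" where
  "cspan = closure (span (range e))"

definition coef :: "'a \<Rightarrow> nat \<Rightarrow> 'k" where
  "coef v = (THE a. (\<lambda>n. scl (a n) (e n)) sums v)"

definition psum :: "nat \<Rightarrow> 'a \<Rightarrow> 'a" where
  "psum n v = (\<Sum>i<n. scl (coef v i) (e i))"

lemma coef_unique_exists: "v \<in> cspan \<Longrightarrow> \<exists>!a. (\<lambda>n. scl (a n) (e n)) sums v"
  using basic by (simp add: basic_sequence_def cspan_def)

lemma coef_sums: "v \<in> cspan \<Longrightarrow> (\<lambda>n. scl (coef v n) (e n)) sums v"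
  unfolding coef_def by (rule theI'[OF coef_unique_exists])

lemma coef_eqI: "v \<in> cspan \<Longrightarrow> (\<lambda>n. scl (a n) (e n)) sums v \<Longrightarrow> coef v = a"
  using coef_unique_exists[of v] coef_sums[of v] by blast

lemma psum_tendsto: "v \<in> cspan \<Longrightarrow> (\<lambda>n. psum n v) \<longlonglongrightarrow> v"
  using coef_sums[of v] by (simp add: sums_def psum_def)

lemma span_subset_cspan: "span (range e) \<subseteq> cspan"
  by (simp add: cspan_def closure_subset)

lemma e_in_cspan: "e n \<in> cspan"
  using span_subset_cspan span_base by blast

lemma closed_cspan: "closed cspan"
  by (simp add: cspan_def)

lemma zero_in_cspan: "0 \<in> cspan"
  using span_subset_cspan span_zero by blast

lemma cspan_add:
  assumes "u \<in> cspan" "v \<in> cspan" shows "u + v \<in> cspan"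
proof -
  obtain x y where "\<forall>n. x n \<in> span (range e)" "x \<longlonglongrightarrow> u" "\<forall>n. y n \<in> span (range e)" "y \<longlonglongrightarrow> v"
    using assms unfolding cspan_def closure_sequential by blast
  then show ?thesis
    unfolding cspan_def closure_sequential
    by (intro exI[of _ "\<lambda>n. x n + y n"]) (auto intro: span_add tendsto_add)
qed

lemma cspan_scl:
  assumes "u \<in> cspan" shows "scl c u \<in> cspan"
proof -
  obtain x where "\<forall>n. x n \<in> span (range e)" "x \<longlonglongrightarrow> u"
    using assms unfolding cspan_def closure_sequential by blast
  then show ?thesis
    unfolding cspan_def closure_sequential
    by (intro exI[of _ "\<lambda>n. scl c (x n)"])
      (auto intro: span_scale bounded_linear.tendsto[OF bounded_linear_scl])
qed

lemma cspan_diff: "u \<in> cspan \<Longrightarrow> v \<in> cspan \<Longrightarrow> u - v \<in> cspan"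
  using cspan_add[of u "- v"] cspan_scl[of v "- 1"] by simp

lemma coef_add: "u \<in> cspan \<Longrightarrow> v \<in> cspan \<Longrightarrow> coef (u + v) = (\<lambda>n. coef u n + coef v n)"
  using sums_add[OF coef_sums coef_sums] by (intro coef_eqI) (simp_all add: scale_left_distrib cspan_add)

lemma coef_scl: "u \<in> cspan \<Longrightarrow> coef (scl c u) = (\<lambda>n. c * coef u n)"
  using bounded_linear.sums[OF bounded_linear_scl[of c] coef_sums] by (intro coef_eqI) (simp_all add: cspan_scl)

lemma coef_diff: "u \<in> cspan \<Longrightarrow> v \<in> cspan \<Longrightarrow> coef (u - v) = (\<lambda>n. coef u n - coef v n)"
  using coef_add[of u "- v"] coef_scl[of v "- 1"] cspan_scl[of v "- 1"] by simp

lemma e_sums: "(\<lambda>i. scl (if i = n then c else 0) (e i)) sums scl c (e n)"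
  using sums_single[of n "\<lambda>i. scl c (e i)"] by (simp add: if_distrib[of "\<lambda>c. scl c _"] cong: if_cong)

lemma coef_e: "coef (e n) = (\<lambda>i. if i = n then 1 else 0)"
  using e_sums[of n 1] by (intro coef_eqI e_in_cspan) simp

lemma e_nonzero: "e n \<noteq> 0"
proof
  assume "e n = 0"
  then have "coef (e n) = (\<lambda>i. 0)"
    by (intro coef_eqI e_in_cspan) simp
  with coef_e[of n] show False
    by (metis zero_neq_one)
qed

lemma psum_diff: "u \<in> cspan \<Longrightarrow> v \<in> cspan \<Longrightarrow> psum n (u - v) = psum n u - psum n v"
  by (simp add: psum_def coef_diff scale_left_diff_distrib sum_subtractf)

lemma psum_scl: "u \<in> cspan \<Longrightarrow> psum n (scl c u) = scl c (psum n u)"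
  by (simp add: psum_def coef_scl scale_sum_right)

lemma scl_coef_eq_psum: "scl (coef v n) (e n) = psum (Suc n) v - psum n v"
  by (simp add: psum_def)

text \<open>The argument must not presuppose continuity of coordinates. Each term of an expansion is
  a difference of consecutive partial sums, so the coordinates are Cauchy along \<open>u\<close> and
  converge, the scalars being complete. The limits define a series whose partial sums stay within
  \<open>\<epsilon> l\<close> of those of \<open>u l\<close>. It converges to \<open>v\<close>, and
  uniqueness identifies it with the expansion of \<open>v\<close>.\<close>

lemma psum_uniform_limit:
  assumes u: "\<And>j. u j \<in> cspan" "u \<longlonglongrightarrow> v"
    and \<epsilon>: "\<And>j l n. l \<le> j \<Longrightarrow> norm (psum n (u j - u l)) \<le> \<epsilon> l" "\<epsilon> \<longlonglongrightarrow> 0"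
  shows "norm (psum n (v - u l)) \<le> \<epsilon> l"
proof -
  have v: "v \<in> cspan"
    using closed_sequentially[OF closed_cspan] u by blast
  have "\<exists>b. (\<lambda>j. coef (u j) i) \<longlonglongrightarrow> b" for i
  proof -
    have dist: "norm (scl (coef (u j) i) (e i) - scl (coef (u l) i) (e i)) \<le> 2 * \<epsilon> l" if "l \<le> j" for j l
    proof -
      have "scl (coef (u j) i) (e i) - scl (coef (u l) i) (e i) = psum (Suc i) (u j - u l) - psum i (u j - u l)"
        by (simp add: scl_coef_eq_psum psum_diff u)
      also have "norm \<dots> \<le> \<epsilon> l + \<epsilon> l"
        by (rule order_trans[OF norm_triangle_ineq4 add_mono]) (use \<epsilon>(1)[OF that] in auto)
      finally show ?thesis
        by simp
    qed
    have "Cauchy (\<lambda>j. scl (coef (u j) i) (e i))"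
    proof (rule CauchyI')
      fix r :: real
      assume "0 < r"
      then have "\<forall>\<^sub>F l in sequentially. \<epsilon> l < r / 2"
        using \<epsilon>(2) by (intro order_tendstoD) auto
      then obtain M where M: "\<And>l. M \<le> l \<Longrightarrow> \<epsilon> l < r / 2"
        unfolding eventually_sequentially by blast
      have "norm (scl (coef (u l) i) (e i) - scl (coef (u j) i) (e i)) < r" if "M \<le> l" "l < j" for l j
        using dist[of l j] M[of l] that by (simp add: norm_minus_commute)
      then show "\<exists>M. \<forall>m\<ge>M. \<forall>n>m. dist (scl (coef (u m) i) (e i)) (scl (coef (u n) i) (e i)) < r"
        unfolding dist_norm by blast
    qed
    then have "Cauchy (\<lambda>j. coef (u j) i)"
      using e_nonzero by (rule Cauchy_scl_cancel)
    then show ?thesis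
      using real_normed_field_complete unfolding convergent_def by blast
  qed
  then obtain b where b: "\<And>i. (\<lambda>j. coef (u j) i) \<longlonglongrightarrow> b i"
    by metis
  define t where "t n = (\<Sum>i<n. scl (b i) (e i))" for n
  have t: "(\<lambda>j. psum n (u j)) \<longlonglongrightarrow> t n" for n
    unfolding psum_def t_def by (intro tendsto_sum tendsto_scl_left b)
  have le: "norm (t n - psum n (u l)) \<le> \<epsilon> l" for n l
  proof (rule tendsto_upperbound)
    show "(\<lambda>j. norm (psum n (u j) - psum n (u l))) \<longlonglongrightarrow> norm (t n - psum n (u l))"
      by (intro tendsto_intros t)
    show "\<forall>\<^sub>F j in sequentially. norm (psum n (u j) - psum n (u l)) \<le> \<epsilon> l"
      unfolding eventually_sequentially using \<epsilon>(1) by (auto simp: psum_diff u)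
  qed simp
  have "t \<longlonglongrightarrow> v"
  proof (rule LIMSEQ_I)
    fix r :: real
    assume "0 < r"
    have "\<forall>\<^sub>F l in sequentially. \<epsilon> l < r / 3" "\<forall>\<^sub>F l in sequentially. dist (u l) v < r / 3"
      using order_tendstoD(2)[OF \<epsilon>(2), of "r / 3"] tendstoD[OF u(2), of "r / 3"] \<open>0 < r\<close> by simp_all
    then have "\<forall>\<^sub>F l in sequentially. \<epsilon> l < r / 3 \<and> dist (u l) v < r / 3"
      by (rule eventually_conj)
    then obtain l where l: "\<epsilon> l < r / 3" "dist (u l) v < r / 3"
      unfolding eventually_sequentially by blast
    obtain M where M: "\<And>n. M \<le> n \<Longrightarrow> norm (psum n (u l) - u l) < r / 3"
      using LIMSEQ_D[OF psum_tendsto[OF u(1)[of l]], of "r / 3"] \<open>0 < r\<close> by auto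
    have "norm (t n - v) < r" if "M \<le> n" for n
    proof -
      have "t n - v = (t n - psum n (u l)) + (psum n (u l) - u l) + (u l - v)"
        by simp
      also have "norm \<dots> \<le> norm (t n - psum n (u l)) + norm (psum n (u l) - u l) + norm (u l - v)"
        by (meson add_mono norm_triangle_ineq order_refl order_trans)
      finally show ?thesis
        using le[of n l] M[OF that] l by (simp add: dist_norm)
    qed
    then show "\<exists>M. \<forall>n\<ge>M. norm (t n - v) < r"
      by blast
  qed
  then have "coef v = b"
    using v by (intro coef_eqI) (simp_all add: sums_def flip: t_def)
  then have "psum n v = t n"
    by (simp add: psum_def t_def)
  then show ?thesis
    using le by (simp add: psum_diff u v)
qed

section \<open>Baire category and uniform boundedness of the partial sums\<close>

lemma psum_bounded: "v \<in> cspan \<Longrightarrow> \<exists>N::nat. \<forall>n. norm (psum n v) \<le> real N"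
proof -
  assume "v \<in> cspan"
  then have "Bseq (\<lambda>n. psum n v)"
    using psum_tendsto convergent_imp_Bseq convergentI by blast
  then obtain B where "\<And>n. norm (psum n v) \<le> B"
    unfolding Bseq_def by blast
  then show ?thesis
    by (meson order_trans real_arch_simple)
qed

text \<open>By Baire's theorem the closure of some \<open>F N\<close> contains a ball of
  \<open>cspan\<close>; translation to the origin and scaling then reach every \<open>w\<close>.
  Since it is the closure that contains the ball, \<open>w\<close> is only approximated.\<close>

lemma psum_bounded_dense:
  obtains D where "0 < D"
    "\<And>w r. w \<in> cspan \<Longrightarrow> 0 < r \<Longrightarrow> \<exists>f\<in>cspan. (\<forall>n. norm (psum n f) \<le> D * norm w) \<and> norm (w - f) \<le> r"
proof -
  define F where "F N = {v \<in> cspan. \<forall>n. norm (psum n v) \<le> real N}" for N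
  let ?X = "top_of_set cspan"
  have F: "closure (F N) \<subseteq> cspan" for N
    by (rule closure_minimal[OF _ closed_cspan]) (auto simp: F_def)
  have "\<exists>N. ?X interior_of (closure (F N)) \<noteq> {}"
  proof (rule ccontr)
    assume "\<not> ?thesis"
    then have empty: "?X interior_of (closure (F N)) = {}" for N
      by blast
    have "completely_metrizable_space ?X"
      using closed_cspan by (simp add: completely_metrizable_space_closedin completely_metrizable_space_euclidean)
    then have "?X interior_of \<Union>(range (\<lambda>N. closure (F N))) = {}"
      using F empty by (intro Baire_category_alt) (auto intro!: closed_subset)
    moreover have "\<Union>(range (\<lambda>N. closure (F N))) = cspan"
    proof
      show "cspan \<subseteq> \<Union>(range (\<lambda>N. closure (F N)))"
      proof
        fix v
        assume "v \<in> cspan"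
        then obtain N where "v \<in> F N"
          using psum_bounded unfolding F_def by blast
        then show "v \<in> \<Union>(range (\<lambda>N. closure (F N)))"
          using closure_subset[of "F N"] by blast
      qed
    qed (use F in blast)
    ultimately have "?X interior_of cspan = {}"
      by simp
    then show False
      using zero_in_cspan interior_of_topspace[of ?X] by auto
  qed
  then obtain N v0 where int: "v0 \<in> ?X interior_of (closure (F N))"
    by blast
  moreover have "openin ?X (?X interior_of (closure (F N)))"
    by simp
  ultimately obtain \<delta> where "0 < \<delta>" "ball v0 \<delta> \<inter> cspan \<subseteq> ?X interior_of (closure (F N))"
    unfolding openin_contains_ball by blast
  with int have v0: "v0 \<in> cspan" "\<And>w. w \<in> cspan \<Longrightarrow> dist w v0 < \<delta> \<Longrightarrow> w \<in> closure (F N)"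
    using interior_of_subset[of ?X "closure (F N)"] F[of N] by (auto simp: subset_iff dist_commute)
  \<comment> \<open>Vectors of norm below \<open>\<delta>\<close> get the bound
    \<open>2 * real N\<close>. Rescaling \<open>w\<close> to norm \<open>\<delta> / 2\<close>
    multiplies this by \<open>2 * norm w / \<delta>\<close>, and \<open>N + 1\<close> in place of
    \<open>N\<close> makes \<open>D\<close> positive.\<close>
  define D where "D = 4 * (real N + 1) / \<delta>"
  have "0 < D"
    using \<open>0 < \<delta>\<close> by (simp add: D_def add_pos_nonneg)
  \<comment> \<open>Approximate both \<open>v0 + w\<close> and \<open>v0\<close> from
    \<open>F N\<close> and subtract.\<close>
  have small: "\<exists>f\<in>cspan. (\<forall>n. norm (psum n f) \<le> 2 * real N) \<and> norm (w - f) \<le> r"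
    if "w \<in> cspan" "norm w < \<delta>" "0 < r" for w r
  proof -
    have "v0 + w \<in> closure (F N)" "v0 \<in> closure (F N)"
      using that v0 \<open>0 < \<delta>\<close> by (auto simp: cspan_add dist_norm)
    then obtain f g where "f \<in> F N" "g \<in> F N" "dist f (v0 + w) < r / 2" "dist g v0 < r / 2"
      using \<open>0 < r\<close> unfolding closure_approachable by (meson half_gt_zero)
    moreover have "norm (w - (f - g)) \<le> dist f (v0 + w) + dist g v0"
    proof -
      have "w - (f - g) = (g - v0) - (f - (v0 + w))"
        by simp
      then show ?thesis
        unfolding dist_norm by (metis add.commute norm_triangle_ineq4)
    qed
    moreover have "norm (psum n f - psum n g) \<le> real N + real N" for n
      using calculation by (intro order_trans[OF norm_triangle_ineq4 add_mono]) (auto simp: F_def)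
    ultimately show ?thesis
      by (intro bexI[of _ "f - g"]) (auto simp: F_def psum_diff cspan_diff)
  qed
  show thesis
  proof (rule that[OF \<open>0 < D\<close>])
    fix w and r :: real
    assume w: "w \<in> cspan" and "0 < r"
    show "\<exists>f\<in>cspan. (\<forall>n. norm (psum n f) \<le> D * norm w) \<and> norm (w - f) \<le> r"
    proof (cases "w = 0")
      case True
      have "psum n 0 = 0" for n
        using psum_scl[OF zero_in_cspan, of n 0] by simp
      then show ?thesis
        using True \<open>0 < r\<close> zero_in_cspan by (intro bexI[of _ 0]) auto
    next
      case False
      define c where "c = \<delta> / (2 * norm w)"
      have "0 < c"
        using False \<open>0 < \<delta>\<close> by (simp add: c_def)
      have scl_c: "norm (scl (of_real s) x) = s * norm x" if "0 < s" for s x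
        using that by (simp add: norm_scl)
      have "norm (scl (of_real c) w) < \<delta>"
        using False \<open>0 < \<delta>\<close> by (simp add: scl_c[OF \<open>0 < c\<close>]) (simp add: c_def)
      then obtain f where f: "f \<in> cspan" "\<And>n. norm (psum n f) \<le> 2 * real N" "norm (scl (of_real c) w - f) \<le> c * r"
        using small[of "scl (of_real c) w" "c * r"] w \<open>0 < c\<close> \<open>0 < r\<close> by (auto simp: cspan_scl)
      define g where "g = scl (of_real (1 / c)) f"
      have "norm (psum n g) \<le> D * norm w" for n
      proof -
        have "norm (psum n g) = (1 / c) * norm (psum n f)"
          unfolding g_def psum_scl[OF f(1)] using \<open>0 < c\<close> by (intro scl_c) simp
        also have "\<dots> \<le> (1 / c) * (2 * (real N + 1))"
          using f(2)[of n] \<open>0 < c\<close> by (intro mult_left_mono) auto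
        also have "\<dots> = D * norm w"
          using False \<open>0 < \<delta>\<close> by (simp add: D_def c_def)
        finally show ?thesis .
      qed
      moreover have "norm (w - g) \<le> r"
      proof -
        have "w - g = scl (of_real (1 / c)) (scl (of_real c) w - f)"
          using \<open>0 < c\<close> by (simp add: g_def scale_right_diff_distrib)
        then have "norm (w - g) = (1 / c) * norm (scl (of_real c) w - f)"
          using \<open>0 < c\<close> scl_c[of "1 / c"] by simp
        also have "\<dots> \<le> (1 / c) * (c * r)"
          using f(3) \<open>0 < c\<close> by (intro mult_left_mono) auto
        finally show ?thesis
          using \<open>0 < c\<close> by simp
      qed
      ultimately show ?thesis
        using f(1) by (intro bexI[of _ g]) (auto simp: g_def cspan_scl)
    qed
  qed
qed

text \<open>Successive approximation as in the open mapping theorem: the remaining error is halved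
  at each stage, and the partial sums of the corrections are dominated by a geometric series with
  sum \<open>2 * D * norm v\<close>.\<close>

theorem psum_uniformly_bounded:
  obtains C where "\<And>v n. v \<in> cspan \<Longrightarrow> norm (psum n v) \<le> C * norm v"
proof -
  obtain D where "0 < D" and
    D: "\<And>w r. w \<in> cspan \<Longrightarrow> 0 < r \<Longrightarrow> \<exists>f\<in>cspan. (\<forall>n. norm (psum n f) \<le> D * norm w) \<and> norm (w - f) \<le> r"
    by (rule psum_bounded_dense) blast
  show thesis
  proof (rule that)
    fix v n
    assume v: "v \<in> cspan"
    have psum0: "psum n 0 = 0" for n
      using psum_scl[OF zero_in_cspan, of n 0] by simp
    show "norm (psum n v) \<le> (2 * D) * norm v"
    proof (cases "v = 0")
      case False
      define P where "P = (\<lambda>j u. u \<in> cspan \<and> norm (v - u) \<le> norm v / 2 ^ j \<and> (j = 0 \<longrightarrow> u = 0))"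
      define Q where "Q = (\<lambda>j u u'. \<forall>n. norm (psum n (u' - u)) \<le> D * norm v / 2 ^ j)"
      have "\<exists>u. \<forall>j. P j (u j) \<and> Q j (u j) (u (Suc j))"
      proof (rule dependent_nat_choice)
        show "\<exists>u. P 0 u"
          by (intro exI[of _ 0]) (simp add: P_def zero_in_cspan)
        fix u j
        assume u: "P j u"
        then obtain f where f: "f \<in> cspan" "\<And>n. norm (psum n f) \<le> D * norm (v - u)"
            "norm (v - u - f) \<le> norm v / 2 ^ Suc j"
          using D[of "v - u" "norm v / 2 ^ Suc j"] False v by (auto simp: P_def cspan_diff)
        have "norm (psum n f) \<le> D * norm v / 2 ^ j" for n
          using order_trans[OF f(2) mult_left_mono[of "norm (v - u)" "norm v / 2 ^ j" D]] u \<open>0 < D\<close>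
          by (simp add: P_def)
        then show "\<exists>u'. P (Suc j) u' \<and> Q j u u'"
          using u f by (intro exI[of _ "u + f"]) (simp add: P_def Q_def cspan_add algebra_simps)
      qed
      then obtain u where P: "\<And>j. P j (u j)" and Q: "\<And>j. Q j (u j) (u (Suc j))"
        by blast
      have u: "u j \<in> cspan" for j
        using P by (simp add: P_def)
      \<comment> \<open>The subtracted term is the part of the geometric series not yet used. It
        lets the induction close and is dropped afterwards.\<close>
      have tail: "norm (psum n (u j - u l)) \<le> 2 * D * norm v / 2 ^ l - 2 * D * norm v / 2 ^ j" if "l \<le> j" for n j l
        using that
      proof (induction j rule: dec_induct)
        case base
        show ?case
          by (simp add: psum0)
      next
        case (step j)
        have "psum n (u (Suc j) - u l) = psum n (u (Suc j) - u j) + psum n (u j - u l)"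
          by (simp add: psum_diff u)
        also have "norm \<dots> \<le> D * norm v / 2 ^ j + (2 * D * norm v / 2 ^ l - 2 * D * norm v / 2 ^ j)"
          using Q[of j] step.IH by (intro norm_triangle_mono) (auto simp: Q_def)
        also have "\<dots> = 2 * D * norm v / 2 ^ l - 2 * D * norm v / 2 ^ Suc j"
          by (simp add: field_simps)
        finally show ?case .
      qed
      have lim: "(\<lambda>j. c / 2 ^ j) \<longlonglongrightarrow> 0" for c :: real
        using LIMSEQ_divide_realpow_zero[of 2 c] by simp
      \<comment> \<open>The construction starts at \<open>u 0 = 0\<close>, so the estimate at index
        0 concerns \<open>v\<close> itself.\<close>
      have "norm (psum n (v - u 0)) \<le> 2 * D * norm v / 2 ^ 0"
      proof (rule psum_uniform_limit[where \<epsilon> = "\<lambda>l. 2 * D * norm v / 2 ^ l", OF u])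
        have "(\<lambda>j. v - u j) \<longlonglongrightarrow> 0"
          using P by (intro Lim_null_comparison[OF _ lim[of "norm v"]]) (simp add: P_def)
        then show "u \<longlonglongrightarrow> v"
          using tendsto_diff[OF tendsto_const[of v], of "\<lambda>j. v - u j" 0] by simp
        show "norm (psum n (u j - u l)) \<le> 2 * D * norm v / 2 ^ l" if "l \<le> j" for j l n
          using tail[OF that, of n] \<open>0 < D\<close> by (smt (verit) divide_nonneg_nonneg mult_nonneg_nonneg norm_ge_zero zero_le_power)
      qed (rule lim)
      moreover have "u 0 = 0"
        using P[of 0] by (simp add: P_def)
      ultimately show ?thesis
        by simp
    qed (simp add: psum0)
  qed
qed

text \<open>Coordinates outside \<open>range r\<close> vanish on the span of the subsequence. By the
  uniform bound on partial sums they are continuous, so they vanish on its closure, and the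
  expansion along \<open>e\<close> is already one along \<open>e \<circ> r\<close>.\<close>

lemma basic_sequence_subseq:
  assumes "strict_mono r"
  shows "basic_sequence scl (e \<circ> r)"
  unfolding basic_sequence_def
proof
  fix v
  assume "v \<in> closure (span (range (e \<circ> r)))"
  then obtain x where x: "\<And>j. x j \<in> span (range (e \<circ> r))" "x \<longlonglongrightarrow> v"
    unfolding closure_sequential by blast
  obtain C where C: "\<And>v n. v \<in> cspan \<Longrightarrow> norm (psum n v) \<le> C * norm v"
    using psum_uniformly_bounded by blast
  have "span (range (e \<circ> r)) \<subseteq> span (range e)"
    by (intro span_mono) auto
  then have xc: "x j \<in> cspan" for j
    using x(1) span_subset_cspan by blast
  then have v: "v \<in> cspan"
    using closed_sequentially[OF closed_cspan] x(2) by blast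
  have zero: "coef w n = 0" if "w \<in> span (range (e \<circ> r))" "n \<notin> range r" for w n
  proof -
    have "w \<in> cspan \<and> coef w n = 0"
      using that(1)
    proof (induction rule: span_induct_alt)
      case base
      have "coef 0 = (\<lambda>i. 0)"
        by (intro coef_eqI zero_in_cspan) simp
      then show ?case
        using zero_in_cspan by simp
    next
      case (step c y w)
      then show ?case
        using that(2) by (auto simp: coef_add coef_scl coef_e cspan_add cspan_scl e_in_cspan)
    qed
    then show ?thesis ..
  qed
  have "coef v n = 0" if "n \<notin> range r" for n
  proof -
    have "norm (scl (coef v n) (e n)) \<le> 2 * C * norm (v - x j)" for j
    proof -
      have "scl (coef v n) (e n) = scl (coef (v - x j) n) (e n)"
        using zero[OF x(1) that] by (simp add: coef_diff v xc)
      also have "\<dots> = psum (Suc n) (v - x j) - psum n (v - x j)"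
        by (rule scl_coef_eq_psum)
      also have "norm \<dots> \<le> C * norm (v - x j) + C * norm (v - x j)"
        by (intro order_trans[OF norm_triangle_ineq4 add_mono] C cspan_diff v xc)
      finally show ?thesis
        by simp
    qed
    moreover have "(\<lambda>j. 2 * C * norm (v - x j)) \<longlonglongrightarrow> 2 * C * norm (v - v)"
      by (intro tendsto_intros x)
    ultimately have "norm (scl (coef v n) (e n)) \<le> 2 * C * norm (v - v)"
      by (intro tendsto_lowerbound[where F = sequentially]) auto
    then show ?thesis
      using e_nonzero[of n] by (simp add: norm_scl mult_le_0_iff)
  qed
  then have "(\<lambda>n. scl ((coef v \<circ> r) n) ((e \<circ> r) n)) sums v"
    using coef_sums[OF v] sums_mono_reindex[OF assms, of "\<lambda>n. scl (coef v n) (e n)"] by simp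
  moreover have "a = coef v \<circ> r" if a: "(\<lambda>n. scl (a n) ((e \<circ> r) n)) sums v" for a
  proof -
    \<comment> \<open>Filling up with zeros turns an expansion along \<open>e \<circ> r\<close> into
      one along \<open>e\<close>, where uniqueness is known.\<close>
    define b where "b n = (if n \<in> range r then a (inv r n) else 0)" for n
    have br: "b (r n) = a n" for n
      using strict_mono_imp_inj_on[OF assms] by (simp add: b_def)
    have "(\<lambda>n. scl (b (r n)) (e (r n))) sums v"
      using a by (simp add: br)
    then have "(\<lambda>n. scl (b n) (e n)) sums v"
      by (subst (asm) sums_mono_reindex[OF assms, of "\<lambda>n. scl (b n) (e n)"]) (auto simp: b_def)
    then have "coef v = b"
      by (intro coef_eqI v)
    then show ?thesis
      by (auto simp: br fun_eq_iff)
  qed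
  ultimately show "\<exists>!a. (\<lambda>n. scl (a n) ((e \<circ> r) n)) sums v"
    by (rule ex1I)
qed

end

section \<open>Ramsey stabilization of a sequence\<close>

text \<open>Ramsey's theorem for \<open>k\<close>-element sets, with sets written as increasing
  lists so that a colour can refer to positions. The map \<open>r\<close> enumerates the homogeneous
  set, and \<open>f\<close> numbers the colours.\<close>

lemma ramsey_sorted_lists:
  fixes C :: "nat list \<Rightarrow> 'c::finite"
  shows "\<exists>(r :: nat \<Rightarrow> nat) c. strict_mono r \<and>
    (\<forall>l. length l = k \<longrightarrow> sorted_wrt (<) l \<longrightarrow> C (map r l) = c)"
proof -
  obtain f :: "'c \<Rightarrow> nat" and n where f: "f ` UNIV = {i. i < n}" "inj f"
    using finite_imp_inj_to_nat_seg[of "UNIV :: 'c set"] by auto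
  define g where "g X = f (C (sorted_list_of_set X))" for X
  have "g X < n" for X
    using f(1) unfolding g_def by blast
  then obtain Y t where Y: "infinite Y" "t < n" "\<And>X. X \<subseteq> Y \<Longrightarrow> finite X \<Longrightarrow> card X = k \<Longrightarrow> g X = t"
    using Ramsey[of "UNIV :: nat set" k g n] by auto
  obtain c where c: "f c = t"
    using f(1) Y(2) by (metis imageE mem_Collect_eq)
  show ?thesis
  proof (intro exI conjI allI impI)
    show mono: "strict_mono (enumerate Y)"
      using Y(1) by (rule strict_mono_enumerate)
    fix l :: "nat list"
    assume l: "length l = k" "sorted_wrt (<) l"
    let ?l = "map (enumerate Y) l"
    have "sorted_wrt (<) ?l"
      using l(2) mono by (auto simp: sorted_wrt_map strict_mono_def elim: sorted_wrt_mono_rel[rotated])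
    then have "sorted ?l" "distinct ?l"
      by (simp_all add: strict_sorted_iff)
    then have "sorted_list_of_set (set ?l) = ?l"
      by (rule sorted_list_of_set.idem_if_sorted_distinct)
    moreover have "g (set ?l) = t"
      using l(1) Y(1) distinct_card[OF \<open>distinct ?l\<close>] by (intro Y(3)) (auto simp: enumerate_in_set)
    ultimately show "C ?l = c"
      by (metis c f(2) g_def inj_eq)
  qed
qed

section \<open>Equivalence of finite families and stable sequences\<close>

context banach_over
begin

text \<open>Fixing the constant and the length turns equivalence into a two-valued property of
  finitely many indices, which Ramsey's theorem can stabilize.\<close>

definition family_equiv :: "real \<Rightarrow> nat \<Rightarrow> (nat \<Rightarrow> 'a) \<Rightarrow> (nat \<Rightarrow> 'a) \<Rightarrow> bool" where
  "family_equiv K n f g \<longleftrightarrow> (\<forall>a.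
     norm (\<Sum>i<n. scl (a i) (f i)) \<le> K * norm (\<Sum>i<n. scl (a i) (g i)) \<and>
     norm (\<Sum>i<n. scl (a i) (g i)) \<le> K * norm (\<Sum>i<n. scl (a i) (f i)))"

lemma family_equiv_sym: "family_equiv K n f g \<Longrightarrow> family_equiv K n g f"
  by (simp add: family_equiv_def)

lemma family_equiv_cong:
  assumes "\<And>i. i < n \<Longrightarrow> f i = f' i" "\<And>i. i < n \<Longrightarrow> g i = g' i"
  shows "family_equiv K n f g \<longleftrightarrow> family_equiv K n f' g'"
  using assms by (simp add: family_equiv_def)

lemma family_equiv_trans:
  assumes fg: "family_equiv K n f g" and gh: "family_equiv L n g h" and "0 \<le> K" "0 \<le> L"
  shows "family_equiv (K * L) n f h"
  unfolding family_equiv_def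
proof
  fix a
  let ?s = "\<lambda>f. norm (\<Sum>i<n. scl (a i) (f i))"
  have "?s f \<le> K * ?s g" "?s g \<le> K * ?s f" "?s g \<le> L * ?s h" "?s h \<le> L * ?s g"
    using fg gh by (auto simp: family_equiv_def)
  then have "?s f \<le> K * (L * ?s h)" "?s h \<le> L * (K * ?s f)"
    using \<open>0 \<le> K\<close> \<open>0 \<le> L\<close> by (meson mult_left_mono order_trans)+
  then show "?s f \<le> K * L * ?s h \<and> ?s h \<le> K * L * ?s f"
    by (simp add: ac_simps)
qed

text \<open>As \<open>b\<close> is injective, coefficients can be moved to the positions
  \<open>b i\<close> and set to 0 elsewhere. This covers subfamilies and permutations alike.\<close>

lemma family_equiv_reindex:
  assumes fg: "family_equiv K n f g" and b: "inj_on b {..<k}" "b ` {..<k} \<subseteq> {..<n}"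
  shows "family_equiv K k (\<lambda>i. f (b i)) (\<lambda>i. g (b i))"
  unfolding family_equiv_def
proof
  fix a :: "nat \<Rightarrow> 'k"
  define a' where "a' j = (if j \<in> b ` {..<k} then a (inv_into {..<k} b j) else 0)" for j
  have "(\<Sum>j<n. scl (a' j) (f j)) = (\<Sum>i<k. scl (a i) (f (b i)))" for f
  proof -
    have "(\<Sum>j<n. scl (a' j) (f j)) = (\<Sum>j\<in>b ` {..<k}. scl (a' j) (f j))"
      using b(2) by (intro sum.mono_neutral_right) (auto simp: a'_def)
    also have "\<dots> = (\<Sum>i<k. scl (a i) (f (b i)))"
      by (simp add: sum.reindex[OF b(1)] a'_def inv_into_f_f[OF b(1)])
    finally show ?thesis .
  qed
  then show "norm (\<Sum>i<k. scl (a i) (f (b i))) \<le> K * norm (\<Sum>i<k. scl (a i) (g (b i))) \<and>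
      norm (\<Sum>i<k. scl (a i) (g (b i))) \<le> K * norm (\<Sum>i<k. scl (a i) (f (b i)))"
    using fg unfolding family_equiv_def by metis
qed

lemma family_equiv_reindex_iff:
  assumes "bij_betw b {..<k} {..<k}" "\<And>i. i < k \<Longrightarrow> b (b i) = i"
  shows "family_equiv K k (\<lambda>i. f (b i)) (\<lambda>i. g (b i)) \<longleftrightarrow> family_equiv K k f g"
proof
  have b: "inj_on b {..<k}" "b ` {..<k} \<subseteq> {..<k}"
    using assms(1) by (auto simp: bij_betw_def)
  show "family_equiv K k (\<lambda>i. f (b i)) (\<lambda>i. g (b i))" if "family_equiv K k f g"
    using family_equiv_reindex[OF that b] .
  assume "family_equiv K k (\<lambda>i. f (b i)) (\<lambda>i. g (b i))"
  from family_equiv_reindex[OF this b] show "family_equiv K k f g"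
    by (subst (asm) family_equiv_cong[where f' = f and g' = g]) (simp_all add: assms(2))
qed

lemma family_equiv_scl_right:
  assumes "family_equiv K n f (\<lambda>i. scl c (g i))" "norm c = 1"
  shows "family_equiv K n f g"
proof -
  have "norm (\<Sum>i<n. scl (a i) (scl c (g i))) = norm (\<Sum>i<n. scl (a i) (g i))" for a
  proof -
    have "(\<Sum>i<n. scl (a i) (scl c (g i))) = scl c (\<Sum>i<n. scl (a i) (g i))"
      by (simp add: scale_sum_right mult.commute)
    then show ?thesis
      by (simp add: norm_scl assms(2))
  qed
  then show ?thesis
    using assms(1) by (simp add: family_equiv_def)
qed

lemma family_equiv_mono:
  assumes "family_equiv K n f g" "K \<le> L"
  shows "family_equiv L n f g"
  using assms(1) unfolding family_equiv_def
  by (meson assms(2) mult_right_mono norm_ge_zero order_trans)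

text \<open>Sums up to an included index \<open>k\<close> have length \<open>Suc k\<close>; the
  additional length 0 is trivial.\<close>

lemma seq_equivalent_iff:
  "seq_equivalent scl x y \<longleftrightarrow> (\<exists>K\<ge>1. \<forall>n. family_equiv K n x y)"
proof -
  have "(\<forall>(k::nat) a. 1 / K * norm (\<Sum>n\<le>k. scl (a n) (x n)) \<le> norm (\<Sum>n\<le>k. scl (a n) (y n)) \<and>
           norm (\<Sum>n\<le>k. scl (a n) (y n)) \<le> K * norm (\<Sum>n\<le>k. scl (a n) (x n))) \<longleftrightarrow>
        (\<forall>n. family_equiv K n x y)" if "1 \<le> K" for K :: real
  proof -
    have "(\<forall>n. family_equiv K n x y) \<longleftrightarrow> (\<forall>n. family_equiv K (Suc n) x y)"
    proof
      assume *: "\<forall>n. family_equiv K (Suc n) x y"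
      show "\<forall>n. family_equiv K n x y"
      proof
        fix n
        show "family_equiv K n x y"
          using * by (cases n) (auto simp: family_equiv_def)
      qed
    qed blast
    moreover have "1 / K * s \<le> t \<longleftrightarrow> s \<le> K * t" for s t :: real
      using that by (simp add: field_simps)
    ultimately show ?thesis
      unfolding family_equiv_def by (simp add: lessThan_Suc_atMost)
  qed
  then show ?thesis
    unfolding seq_equivalent_def by blast
qed

text \<open>One increasing list of length \<open>n + n\<close> encodes two successive blocks.
  Natural constants \<open>M\<close> leave countably many pairs to stabilize, as a diagonal argument
  requires.\<close>

definition stable :: "(nat \<Rightarrow> 'a) \<Rightarrow> bool" where
  "stable x \<longleftrightarrow> (\<forall>n M :: nat. \<exists>N c. \<forall>l.
     length l = n + n \<longrightarrow> sorted_wrt (<) l \<longrightarrow> (\<forall>i\<in>set l. N \<le> i) \<longrightarrow>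
     family_equiv (real M) n (\<lambda>i. x (l ! i)) (\<lambda>i. x (l ! (n + i))) = c)"

text \<open>Ramsey's theorem is applied to each pair \<open>(n, M)\<close> in turn, numbered by
  \<open>prod_encode\<close>, and the diagonal sequence is homogeneous for every pair up to finitely
  many terms.\<close>

lemma stable_subsequence:
  fixes e :: "nat \<Rightarrow> 'a"
  shows "\<exists>d. strict_mono d \<and> stable (e \<circ> d)"
proof -
  define Q where "Q n M s c \<longleftrightarrow> (\<forall>l. length l = n + n \<longrightarrow> sorted_wrt (<) l \<longrightarrow>
      family_equiv (real M) n (\<lambda>i. e (s (l ! i))) (\<lambda>i. e (s (l ! (n + i)))) = c)"
    for n M :: nat and s :: "nat \<Rightarrow> nat" and c :: bool
  define P where "P N s \<longleftrightarrow> (\<exists>c. Q (fst (prod_decode N)) (snd (prod_decode N)) s c)" for N s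
  interpret subseqs P
  proof
    fix N :: nat and s :: "nat \<Rightarrow> nat"
    obtain n M where nM: "prod_decode N = (n, M)"
      by fastforce
    obtain r :: "nat \<Rightarrow> nat" and c where r: "strict_mono r" "\<forall>l. length l = n + n \<longrightarrow> sorted_wrt (<) l \<longrightarrow>
        family_equiv (real M) n (\<lambda>i. e (s (map r l ! i))) (\<lambda>i. e (s (map r l ! (n + i)))) = c"
      using ramsey_sorted_lists[of "n + n"
          "\<lambda>l. family_equiv (real M) n (\<lambda>i. e (s (l ! i))) (\<lambda>i. e (s (l ! (n + i))))"] by blast
    have "Q n M (s \<circ> r) c"
      unfolding Q_def
    proof (intro allI impI)
      fix l :: "nat list"
      assume l: "length l = n + n" "sorted_wrt (<) l"
      have "family_equiv (real M) n (\<lambda>i. e ((s \<circ> r) (l ! i))) (\<lambda>i. e ((s \<circ> r) (l ! (n + i)))) =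
          family_equiv (real M) n (\<lambda>i. e (s (map r l ! i))) (\<lambda>i. e (s (map r l ! (n + i))))"
        by (rule family_equiv_cong) (simp_all add: l)
      with r(2) l show "family_equiv (real M) n (\<lambda>i. e ((s \<circ> r) (l ! i))) (\<lambda>i. e ((s \<circ> r) (l ! (n + i)))) = c"
        by simp
    qed
    then show "\<exists>r. strict_mono r \<and> P N (s \<circ> r)"
      using r(1) nM unfolding P_def by auto
  qed
  \<comment> \<open>Homogeneity passes to subsequences, and this tail of the diagonal sequence is a
    subsequence of the refinement made for \<open>N\<close>.\<close>
  have diag: "P N (diagseq \<circ> (+) (Suc N))" for N
  proof (rule diagseq_holds)
    fix r s :: "nat \<Rightarrow> nat" and N
    assume r: "strict_mono r" and "P N s"
    obtain n M where nM: "prod_decode N = (n, M)"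
      by fastforce
    then obtain c where c: "Q n M s c"
      using \<open>P N s\<close> unfolding P_def by auto
    have "Q n M (s \<circ> r) c"
      unfolding Q_def
    proof (intro allI impI)
      fix l :: "nat list"
      assume l: "length l = n + n" "sorted_wrt (<) l"
      have "family_equiv (real M) n (\<lambda>i. e ((s \<circ> r) (l ! i))) (\<lambda>i. e ((s \<circ> r) (l ! (n + i)))) =
          family_equiv (real M) n (\<lambda>i. e (s (map r l ! i))) (\<lambda>i. e (s (map r l ! (n + i))))"
        by (rule family_equiv_cong) (simp_all add: l)
      also have "sorted_wrt (<) (map r l)"
        using l(2) r by (auto simp: sorted_wrt_map strict_mono_def elim: sorted_wrt_mono_rel[rotated])
      then have "family_equiv (real M) n (\<lambda>i. e (s (map r l ! i))) (\<lambda>i. e (s (map r l ! (n + i)))) = c"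
        using c l(1) unfolding Q_def by (metis length_map)
      finally show "family_equiv (real M) n (\<lambda>i. e ((s \<circ> r) (l ! i))) (\<lambda>i. e ((s \<circ> r) (l ! (n + i)))) = c" .
    qed
    then show "P N (s \<circ> r)"
      using nM unfolding P_def by auto
  qed
  have Q: "\<exists>c. Q n M (diagseq \<circ> (+) (Suc (prod_encode (n, M)))) c" for n M
    using diag[of "prod_encode (n, M)"] by (simp only: P_def prod_encode_inverse fst_conv snd_conv)
  have "stable (e \<circ> diagseq)"
    unfolding stable_def
  proof (intro allI)
    fix n M :: nat
    let ?N = "Suc (prod_encode (n, M))"
    obtain c where c: "Q n M (diagseq \<circ> (+) ?N) c"
      using Q by blast
    have "family_equiv (real M) n (\<lambda>i. (e \<circ> diagseq) (l ! i)) (\<lambda>i. (e \<circ> diagseq) (l ! (n + i))) = c"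
      if l: "length l = n + n" "sorted_wrt (<) l" "\<forall>i\<in>set l. ?N \<le> i" for l
    proof -
      \<comment> \<open>Indices at least \<open>?N\<close> are rewritten as positions in the
        homogeneous tail.\<close>
      let ?l = "map (\<lambda>i. i - ?N) l"
      have "\<forall>i j. i < j \<longrightarrow> j < length l \<longrightarrow> l ! i < l ! j \<and> ?N \<le> l ! i"
        using l by (auto simp: sorted_wrt_iff_nth_less)
      then have "sorted_wrt (<) ?l"
        unfolding sorted_wrt_iff_nth_less by (auto intro!: diff_less_mono)
      then have "family_equiv (real M) n (\<lambda>i. e ((diagseq \<circ> (+) ?N) (?l ! i))) (\<lambda>i. e ((diagseq \<circ> (+) ?N) (?l ! (n + i)))) = c"
        using c l(1) unfolding Q_def by (metis length_map)
      moreover have "family_equiv (real M) n (\<lambda>i. e ((diagseq \<circ> (+) ?N) (?l ! i))) (\<lambda>i. e ((diagseq \<circ> (+) ?N) (?l ! (n + i)))) \<longleftrightarrow>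
          family_equiv (real M) n (\<lambda>i. (e \<circ> diagseq) (l ! i)) (\<lambda>i. (e \<circ> diagseq) (l ! (n + i)))"
      proof (rule family_equiv_cong)
        have *: "?N + (l ! i - ?N) = l ! i" if "i < length l" for i
          using l(3) that by (metis le_add_diff_inverse nth_mem)
        show "e ((diagseq \<circ> (+) ?N) (?l ! i)) = (e \<circ> diagseq) (l ! i)" if "i < n" for i
          using that l(1) *[of i] by simp
        show "e ((diagseq \<circ> (+) ?N) (?l ! (n + i))) = (e \<circ> diagseq) (l ! (n + i))" if "i < n" for i
          using that l(1) *[of "n + i"] by simp
      qed
      ultimately show ?thesis
        by simp
    qed
    then show "\<exists>N c. \<forall>l. length l = n + n \<longrightarrow> sorted_wrt (<) l \<longrightarrow> (\<forall>i\<in>set l. N \<le> i) \<longrightarrow>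
        family_equiv (real M) n (\<lambda>i. (e \<circ> diagseq) (l ! i)) (\<lambda>i. (e \<circ> diagseq) (l ! (n + i))) = c"
      by blast
  qed
  then show ?thesis
    using subseq_diagseq by blast
qed

end

text \<open>The decreasing case is needed because a permutation may reverse the order along a whole
  homogeneous set.\<close>

definition oriented :: "bool \<Rightarrow> nat \<Rightarrow> (nat \<Rightarrow> nat) \<Rightarrow> bool" where
  "oriented up k u \<longleftrightarrow> (\<forall>i j. i < j \<longrightarrow> j < k \<longrightarrow> (if up then u i < u j else u j < u i))"

section \<open>Blocks far out in a stable sequence\<close>

context banach_over
begin

text \<open>Decreasing families reduce to increasing ones, since reversing both with the same
  involution \<open>b\<close> does not affect their equivalence.\<close>

lemma stable_blocks:
  fixes n M :: nat
  assumes "stable x"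
  obtains N c where "\<And>u v. oriented up n u \<Longrightarrow> oriented up n v \<Longrightarrow> (\<And>i. i < n \<Longrightarrow> N \<le> u i) \<Longrightarrow>
      (\<And>i j. i < n \<Longrightarrow> j < n \<Longrightarrow> u i < v j) \<Longrightarrow>
      family_equiv (real M) n (\<lambda>i. x (u i)) (\<lambda>i. x (v i)) = c"
proof -
  obtain N c where N: "\<And>l. length l = n + n \<Longrightarrow> sorted_wrt (<) l \<Longrightarrow> (\<forall>i\<in>set l. N \<le> i) \<Longrightarrow>
      family_equiv (real M) n (\<lambda>i. x (l ! i)) (\<lambda>i. x (l ! (n + i))) = c"
    using assms unfolding stable_def by metis
  define b where "b i = (if up then i else n - 1 - i)" for i
  have "\<forall>i<n. b i < n \<and> b (b i) = i"
    by (auto simp: b_def)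
  then have b: "\<And>i. i < n \<Longrightarrow> b i < n" "\<And>i. i < n \<Longrightarrow> b (b i) = i"
    by auto
  then have bij: "bij_betw b {..<n} {..<n}"
    by (intro bij_betw_byWitness[where f' = b]) auto
  show thesis
  proof (rule that)
    fix u v
    assume u: "oriented up n u" and v: "oriented up n v" and uN: "\<And>i. i < n \<Longrightarrow> N \<le> u i"
      and uv: "\<And>i j. i < n \<Longrightarrow> j < n \<Longrightarrow> u i < v j"
    define l where "l = map (\<lambda>i. u (b i)) [0..<n] @ map (\<lambda>i. v (b i)) [0..<n]"
    have mono: "w (b i) < w (b j)" if "oriented up n w" "i < j" "j < n" for w i j
      using that by (auto simp: oriented_def b_def)
    have "sorted_wrt (<) (map (\<lambda>i. u (b i)) [0..<n])" "sorted_wrt (<) (map (\<lambda>i. v (b i)) [0..<n])"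
      using mono[OF u] mono[OF v] by (auto simp: sorted_wrt_iff_nth_less)
    then have "sorted_wrt (<) l"
      using uv b(1) by (auto simp: l_def sorted_wrt_append)
    moreover have "\<forall>i\<in>set l. N \<le> i"
    proof -
      have "N \<le> v (b i)" if "i < n" for i
        using uN[of i] uv[of i "b i"] b(1) that by fastforce
      then show ?thesis
        using uN b(1) by (auto simp: l_def)
    qed
    ultimately have "family_equiv (real M) n (\<lambda>i. x (l ! i)) (\<lambda>i. x (l ! (n + i))) = c"
      by (intro N) (simp_all add: l_def)
    also have "family_equiv (real M) n (\<lambda>i. x (l ! i)) (\<lambda>i. x (l ! (n + i))) \<longleftrightarrow>
        family_equiv (real M) n (\<lambda>i. x (u (b i))) (\<lambda>i. x (v (b i)))"
      by (rule family_equiv_cong) (simp_all add: l_def nth_append)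
    also have "\<dots> \<longleftrightarrow> family_equiv (real M) n (\<lambda>i. x (u i)) (\<lambda>i. x (v i))"
      by (rule family_equiv_reindex_iff[OF bij b(2), of _ "\<lambda>i. x (u i)" "\<lambda>i. x (v i)"])
    finally show "family_equiv (real M) n (\<lambda>i. x (u i)) (\<lambda>i. x (v i)) = c" .
  qed
qed

text \<open>One equivalent pair beyond the threshold decides that the stabilized truth value is
  true. Two arbitrary far families, possibly interlaced, are then compared through a third one
  beyond both, which squares the constant.\<close>

lemma stable_oriented_equiv:
  fixes n M :: nat
  assumes "stable x"
    and far: "\<And>N. \<exists>u v. oriented up n u \<and> oriented up n v \<and> (\<forall>i<n. N \<le> u i) \<and>
      (\<forall>i<n. \<forall>j<n. u i < v j) \<and> family_equiv (real M) n (\<lambda>i. x (u i)) (\<lambda>i. x (v i))"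
  obtains N where "\<And>u v. oriented up n u \<Longrightarrow> oriented up n v \<Longrightarrow> (\<And>i. i < n \<Longrightarrow> N \<le> u i) \<Longrightarrow>
      (\<And>i. i < n \<Longrightarrow> N \<le> v i) \<Longrightarrow>
      family_equiv (real M * real M) n (\<lambda>i. x (u i)) (\<lambda>i. x (v i))"
proof -
  obtain N c where N: "\<And>u v. oriented up n u \<Longrightarrow> oriented up n v \<Longrightarrow> (\<And>i. i < n \<Longrightarrow> N \<le> u i) \<Longrightarrow>
      (\<And>i j. i < n \<Longrightarrow> j < n \<Longrightarrow> u i < v j) \<Longrightarrow>
      family_equiv (real M) n (\<lambda>i. x (u i)) (\<lambda>i. x (v i)) = c"
    using stable_blocks[OF assms(1), of up n M] by blast
  have c
    using far[of N] N by blast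
  show thesis
  proof (rule that)
    fix u v
    assume u: "oriented up n u" "\<And>i. i < n \<Longrightarrow> N \<le> u i" and v: "oriented up n v" "\<And>i. i < n \<Longrightarrow> N \<le> v i"
    \<comment> \<open>The sum lies above all values of \<open>u\<close> and \<open>v\<close>; the
      last summand provides the orientation.\<close>
    define w where "w i = Suc (\<Sum>i<n. u i + v i) + (if up then i else n - i)" for i
    have w: "oriented up n w"
      by (auto simp: oriented_def w_def)
    have "u i + v i \<le> (\<Sum>i<n. u i + v i)" if "i < n" for i
      using that by (intro member_le_sum) auto
    then have less: "u i < w j" "v i < w j" if "i < n" for i j
      using that unfolding w_def by fastforce+
    have "family_equiv (real M) n (\<lambda>i. x (u i)) (\<lambda>i. x (w i)) = c"
      by (rule N[OF u(1) w]) (simp_all add: u(2) less)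
    moreover have "family_equiv (real M) n (\<lambda>i. x (v i)) (\<lambda>i. x (w i)) = c"
      by (rule N[OF v(1) w]) (simp_all add: v(2) less)
    ultimately show "family_equiv (real M * real M) n (\<lambda>i. x (u i)) (\<lambda>i. x (v i))"
      using \<open>c\<close> family_equiv_trans[OF _ family_equiv_sym, of "real M" n "\<lambda>i. x (u i)" "\<lambda>i. x (w i)" "real M" "\<lambda>i. x (v i)"]
      by simp
  qed
qed

end

section \<open>The dichotomy\<close>

context banach_over
begin

text \<open>Here \<open>p m\<close> and \<open>\<eta> m\<close> describe a signed, reordered copy of
  \<open>y\<close> inside \<open>x\<close> that avoids the indices from \<open>m0\<close> to
  \<open>m\<close>. The constant \<open>K\<close> does not depend on \<open>m\<close>, which makes
  the final constant independent of the length \<open>k\<close>.\<close>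

lemma stable_imp_equivalent_subsequences:
  fixes p :: "nat \<Rightarrow> nat \<Rightarrow> nat" and \<eta> :: "nat \<Rightarrow> nat \<Rightarrow> 'k" and K :: nat
  assumes "stable x" and "1 \<le> K"
    and inj: "\<And>m. inj (p m)" and gap: "\<And>m i. p m i < m0 \<or> m < p m i"
    and signs: "\<And>m i. \<eta> m i \<in> {- 1, 1}"
    and equiv: "\<And>m n. family_equiv (real K) n y (\<lambda>i. scl (\<eta> m i) (x (p m i)))"
  shows "\<exists>h. strict_mono h \<and> (\<exists>L\<ge>1. \<forall>b k. strict_mono b \<longrightarrow> family_equiv L k (y \<circ> h) (y \<circ> h \<circ> b))"
proof -
  \<comment> \<open>The colour of a triple \<open>i < j < m\<close> records the order of
    \<open>p m i\<close> and \<open>p m j\<close>, the side of the gap on which \<open>p m i\<close>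
    lies, and the sign at \<open>i\<close>.\<close>
  obtain h :: "nat \<Rightarrow> nat" and up low sg where h: "strict_mono h" and "\<forall>l. length l = 3 \<longrightarrow> sorted_wrt (<) l \<longrightarrow>
      (\<lambda>l. (p (l ! 2) (l ! 0) < p (l ! 2) (l ! 1), p (l ! 2) (l ! 0) < m0, \<eta> (l ! 2) (l ! 0) = 1)) (map h l)
        = (up, low, sg)"
    using ramsey_sorted_lists[of 3
        "\<lambda>l. (p (l ! 2) (l ! 0) < p (l ! 2) (l ! 1), p (l ! 2) (l ! 0) < m0, \<eta> (l ! 2) (l ! 0) = 1)"] by auto
  then have hom: "(p (h m) (h i) < p (h m) (h j)) = up \<and> (p (h m) (h i) < m0) = low \<and> (\<eta> (h m) (h i) = 1) = sg"
    if "i < j" "j < m" for i j m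
    using that by (auto dest!: spec[of _ "[i, j, m]"])
  have inj_h: "inj_on (\<lambda>i. p (h m) (h i)) S" for m S
    using inj_compose[OF inj[of "h m"] strict_mono_imp_inj_on[OF h]] by (auto simp: o_def intro: inj_on_subset)
  have "\<not> low"
  proof
    assume low
    \<comment> \<open>Pigeonhole: \<open>m0 + 1\<close> indices would be mapped injectively to
      \<open>m0\<close> values.\<close>
    then have "(\<lambda>i. p (h (m0 + 2)) (h i)) ` {..m0} \<subseteq> {..<m0}"
      using hom[of _ "Suc m0" "m0 + 2"] by auto
    from card_inj_on_le[OF inj_h this] show False
      by simp
  qed
  define u where "u m i = p (h m) (h i)" for m i
  have orient: "oriented up k (u m)" if "k < m" for k m
    unfolding oriented_def
  proof (intro allI impI)
    fix i j
    assume ij: "i < j" "j < k"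
    then have "u m i \<noteq> u m j"
      using inj_h[of m UNIV] by (auto simp: u_def inj_on_def)
    then show "if up then u m i < u m j else u m j < u m i"
      using hom[of i j m] ij that by (auto simp: u_def)
  qed
  \<comment> \<open>The colouring speaks of \<open>i\<close> only through triples
    \<open>i < j < m\<close>, so an index must fit between \<open>i\<close> and
    \<open>m\<close>.\<close>
  have far: "m < u m i" if "Suc i < m" for i m
  proof -
    have "h m < u m i"
      using gap[of "h m" "h i"] hom[of i "Suc i" m] that \<open>\<not> low\<close> by (auto simp: u_def)
    then show ?thesis
      using strict_mono_imp_increasing[OF h, of m] by simp
  qed
  have yu: "family_equiv (real K) k (y \<circ> h) (\<lambda>i. x (u m i))" if "k < m" for k m
  proof (rule family_equiv_scl_right)
    let ?c = "if sg then 1 else - 1 :: 'k"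
    have "h ` {..<k} \<subseteq> {..<h k}"
      using h by (auto simp: strict_mono_def)
    moreover have "inj_on h {..<k}"
      using h by (rule strict_mono_imp_inj_on)
    ultimately have "family_equiv (real K) k (\<lambda>i. y (h i)) (\<lambda>i. scl (\<eta> (h m) (h i)) (x (p (h m) (h i))))"
      using family_equiv_reindex[OF equiv[of "h k" "h m"], of h k] by simp
    moreover have "\<eta> (h m) (h i) = ?c" if "i < k" for i
      using hom[of i k m] signs[of "h m" "h i"] that \<open>k < m\<close> by auto
    ultimately show "family_equiv (real K) k (y \<circ> h) (\<lambda>i. scl ?c (x (u m i)))"
      by (simp add: u_def cong: family_equiv_cong)
  qed simp
  \<comment> \<open>Blocks \<open>u m\<close> and \<open>u m'\<close> are both
    \<open>K\<close>-equivalent to the same initial segment of \<open>y \<circ> h\<close>, so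
    \<open>K * K\<close> serves for every \<open>k\<close>.\<close>
  have "\<exists>N. \<forall>v w. oriented up k v \<longrightarrow> oriented up k w \<longrightarrow> (\<forall>i<k. N \<le> v i) \<longrightarrow> (\<forall>i<k. N \<le> w i) \<longrightarrow>
      family_equiv (real (K * K) * real (K * K)) k (\<lambda>i. x (v i)) (\<lambda>i. x (w i))" for k
  proof (rule stable_oriented_equiv[OF \<open>stable x\<close>, of up k "K * K"])
    fix N
    define m where "m = k + 2 + N"
    \<comment> \<open>Adding the sum places the whole second block beyond the first.\<close>
    define m' where "m' = m + (\<Sum>i<k. u m i)"
    have le: "u m i \<le> (\<Sum>i<k. u m i)" if "i < k" for i
      using that by (intro member_le_sum) auto
    have "u m i < u m' j" if "i < k" "j < k" for i j
      using le[OF that(1)] far[of j m'] that by (auto simp: m'_def m_def)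
    moreover have "N \<le> u m i" if "i < k" for i
      using far[of i m] that by (auto simp: m_def)
    moreover have "family_equiv (real (K * K)) k (\<lambda>i. x (u m i)) (\<lambda>i. x (u m' i))"
      using family_equiv_trans[OF family_equiv_sym[OF yu[of k m]] yu[of k m']] by (simp add: m_def m'_def)
    ultimately show "\<exists>u v. oriented up k u \<and> oriented up k v \<and> (\<forall>i<k. N \<le> u i) \<and> (\<forall>i<k. \<forall>j<k. u i < v j) \<and>
        family_equiv (real (K * K)) k (\<lambda>i. x (u i)) (\<lambda>i. x (v i))"
      using orient[of k m] orient[of k m'] by (auto simp: m_def m'_def)
  qed blast
  then obtain N where N: "\<And>k v w. oriented up k v \<Longrightarrow> oriented up k w \<Longrightarrow> (\<And>i. i < k \<Longrightarrow> N k \<le> v i) \<Longrightarrow>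
      (\<And>i. i < k \<Longrightarrow> N k \<le> w i) \<Longrightarrow>
      family_equiv (real (K * K) * real (K * K)) k (\<lambda>i. x (v i)) (\<lambda>i. x (w i))"
    by metis
  \<comment> \<open>The chain runs from \<open>y \<circ> h\<close> to \<open>u m\<close>, on to
    \<open>u m\<close> along \<open>b\<close>, and back to \<open>y \<circ> h \<circ> b\<close>; the
    middle step costs the square of \<open>K * K\<close>.\<close>
  let ?L = "real K * (real (K * K) * real (K * K)) * real K"
  have "family_equiv ?L k (y \<circ> h) (y \<circ> h \<circ> b)" if b: "strict_mono b" for b k
  proof -
    define m where "m = b k + 2 + N k"
    have k: "k \<le> b k"
      using strict_mono_imp_increasing[OF b] .
    have bi: "b i < b k" if "i < k" for i
      using b that by (auto simp: strict_mono_def)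
    have "inj_on b {..<k}"
      using b by (rule strict_mono_imp_inj_on)
    then have 1: "family_equiv (real K) k (y \<circ> h \<circ> b) (\<lambda>i. x (u m (b i)))"
      using family_equiv_reindex[OF yu[of "b k" m], of b k] bi by (auto simp: m_def comp_def)
    have "oriented up k (\<lambda>i. u m (b i))"
      using orient[of "b k" m] b bi unfolding oriented_def by (auto simp: m_def strict_mono_def)
    then have 2: "family_equiv (real (K * K) * real (K * K)) k (\<lambda>i. x (u m i)) (\<lambda>i. x (u m (b i)))"
    proof (rule N[rotated])
      show "oriented up k (u m)"
        using k by (intro orient) (simp add: m_def)
      show "N k \<le> u m i" if "i < k" for i
        using far[of i m] that k by (simp add: m_def)
      show "N k \<le> u m (b i)" if "i < k" for i
        using far[of "b i" m] bi[OF that] by (simp add: m_def)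
    qed
    have 3: "family_equiv (real K) k (y \<circ> h) (\<lambda>i. x (u m i))"
      using k by (intro yu) (simp add: m_def)
    show ?thesis
      by (rule family_equiv_trans[OF family_equiv_trans[OF 3 2] family_equiv_sym[OF 1]]) auto
  qed
  moreover have "1 \<le> ?L"
  proof -
    have "1 \<le> K * (K * K * (K * K)) * K"
      using \<open>1 \<le> K\<close> by simp
    then have "real 1 \<le> real (K * (K * K * (K * K)) * K)"
      by (simp only: of_nat_le_iff)
    then show ?thesis
      by simp
  qed
  ultimately show ?thesis
    using h by blast
qed

text \<open>If every interval starting at \<open>m0\<close> were avoided by some
  \<open>K\<close>-equivalent copy of \<open>y\<close>, those copies would satisfy the hypotheses of
  \<open>stable_imp_equivalent_subsequences\<close>, contrary to \<open>no\<close>.\<close>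

lemma stable_avoided_interval:
  fixes K m0 :: nat
  assumes "stable x" and "1 \<le> K"
    and no: "\<And>h. strict_mono h \<Longrightarrow>
      \<not> (\<exists>L\<ge>1. \<forall>b k. strict_mono b \<longrightarrow> family_equiv L k (y \<circ> h) (y \<circ> h \<circ> b))"
  shows "\<exists>m>m0. \<nexists>p \<eta>. inj p \<and> (\<forall>i. p i \<notin> {m0..m}) \<and> (\<forall>i. \<eta> i \<in> {- 1, 1}) \<and>
    (\<forall>n. family_equiv (real K) n y (\<lambda>i. scl (\<eta> i) (x (p i))))"
proof (rule ccontr)
  assume "\<not> ?thesis"
  \<comment> \<open>The right end \<open>Suc (m0 + m)\<close> exceeds both \<open>m0\<close> and
    \<open>m\<close>: the first makes it admissible, the second yields the gap condition.\<close>
  then have "\<forall>m. \<exists>p \<eta>. inj p \<and> (\<forall>i. p i \<notin> {m0..Suc (m0 + m)}) \<and> (\<forall>i. \<eta> i \<in> {- 1, 1}) \<and>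
    (\<forall>n. family_equiv (real K) n y (\<lambda>i. scl (\<eta> i) (x (p i))))"
    by (meson less_add_Suc1 less_Suc_eq_le le_add1)
  then obtain p \<eta> where p: "\<And>m. inj (p m)" "\<And>m i. p m i \<notin> {m0..Suc (m0 + m)}"
      "\<And>m i. \<eta> m i \<in> {- 1, 1}" "\<And>m n. family_equiv (real K) n y (\<lambda>i. scl (\<eta> m i) (x (p m i)))"
    by metis
  have "p m i < m0 \<or> m < p m i" for m i
    using p(2)[of m i] by auto
  then show False
    using stable_imp_equivalent_subsequences[OF assms(1,2), where p = p and \<eta> = \<eta> and ?m0.0 = m0 and y = y] p no
    by blast
qed

end

theorem corollary10p6:
  fixes scl :: "'k::real_normed_field \<Rightarrow> 'a::banach \<Rightarrow> 'a"
    and e :: "nat \<Rightarrow> 'a"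
  assumes "banach_over scl"
    and "basic_sequence scl e"
  shows "\<exists>x. subsequence_of x e \<and>
    ((\<forall>y. subsequence_of y x \<longrightarrow>
        (\<exists>I :: nat \<Rightarrow> nat set. successive_intervals I \<and>
          (\<forall>A :: nat set. infinite A \<longrightarrow>
            \<not> (\<exists>z. subsequence_with_indices_in (UNIV - (\<Union>i\<in>A. I i)) z x \<and>
                   signed_perm_equivalent scl y z))))
     \<or> (\<exists>s :: nat \<Rightarrow> 'a. spreading scl s \<and> signed_equivalent scl x s))"
proof -
  interpret basic_seq scl e
    using assms by (simp add: basic_seq_def basic_seq_axioms_def)
  obtain d where d: "strict_mono d" "stable (e \<circ> d)"
    using stable_subsequence by blast
  define x where "x = e \<circ> d"
  show ?thesis
  \<comment> \<open>In the first case the required subsequence is \<open>x \<circ> h\<close>, which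
    is itself spreading. In the second case no subsequence of \<open>x\<close>, hence none of any
    \<open>y\<close>, has the property.\<close>
  proof (cases "\<exists>h. strict_mono h \<and> (\<exists>L\<ge>1. \<forall>b k. strict_mono b \<longrightarrow> family_equiv L k (x \<circ> h) (x \<circ> h \<circ> b))")
    case True
    then obtain h L where h: "strict_mono h" "1 \<le> L"
      "\<And>b k. strict_mono b \<Longrightarrow> family_equiv L k (x \<circ> h) (x \<circ> h \<circ> b)"
      by blast
    have "strict_mono (d \<circ> h)"
      using d(1) h(1) by (rule strict_mono_o)
    then have "subsequence_of (x \<circ> h) e" "basic_sequence scl (x \<circ> h)"
      using basic_sequence_subseq[of "d \<circ> h"] by (auto simp: subsequence_of_def x_def o_assoc)
    moreover have "seq_equivalent scl (x \<circ> h) (x \<circ> h \<circ> b)" if "strict_mono b" for b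
      unfolding seq_equivalent_iff using h that by blast
    ultimately have "spreading scl (x \<circ> h)"
      by (auto simp: spreading_def subsequence_of_def)
    moreover have "seq_equivalent scl (x \<circ> h) (x \<circ> h)"
      unfolding seq_equivalent_iff by (intro exI[of _ 1]) (simp add: family_equiv_def)
    then have "signed_equivalent scl (x \<circ> h) (x \<circ> h)"
      unfolding signed_equivalent_def by (intro exI[of _ "\<lambda>_. 1"]) (simp add: comp_def)
    ultimately show ?thesis
      using \<open>subsequence_of (x \<circ> h) e\<close> by blast
  next
    case False
    have "\<exists>I. successive_intervals I \<and> (\<forall>A. infinite A \<longrightarrow>
            \<not> (\<exists>z. subsequence_with_indices_in (UNIV - (\<Union>i\<in>A. I i)) z x \<and> signed_perm_equivalent scl y z))"
      if y: "subsequence_of y x" for y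
    proof -
      obtain r where r: "strict_mono r" "y = x \<circ> r"
        using y by (auto simp: subsequence_of_def)
      have no: "\<not> (\<exists>L\<ge>1. \<forall>b k. strict_mono b \<longrightarrow> family_equiv L k (y \<circ> h) (y \<circ> h \<circ> b))" if "strict_mono h" for h
        using False strict_mono_o[OF r(1) that] by (auto simp: r(2) comp_assoc)
      \<comment> \<open>The interval meets the indices of every signed, reordered copy of
        \<open>y\<close> with constant \<open>Suc j\<close>. The successor keeps the constant at
        least 1.\<close>
      define hits where "hits j a b \<longleftrightarrow> (\<nexists>p \<eta>. inj p \<and> (\<forall>i. p i \<notin> {a..b}) \<and> (\<forall>i. \<eta> i \<in> {- 1, 1}) \<and>
          (\<forall>n. family_equiv (real (Suc j)) n y (\<lambda>i. scl (\<eta> i) (x (p i)))))" for j a b :: nat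
      have "\<forall>j a. \<exists>b. a < b \<and> hits j a b"
        unfolding hits_def by (intro allI stable_avoided_interval[OF d(2)[folded x_def] _ no]) simp_all
      then obtain m where m: "\<And>j a. a < m j a" "\<And>j a. hits j a (m j a)"
        by metis
      \<comment> \<open>Each interval starts just after the end of the previous one.\<close>
      define s where "s = rec_nat 0 (\<lambda>j s. Suc (m j s))"
      define I where "I j = {s j..m j (s j)}" for j
      have "successive_intervals I"
        unfolding successive_intervals_def nat_interval_def
      proof (intro conjI allI)
        fix j
        show "\<exists>a b. a < b \<and> I j = {a..b}"
          using m(1) unfolding I_def by blast
        have "Max (I j) = m j (s j)" "Min (I (Suc j)) = s (Suc j)"
          using m(1) by (auto simp: I_def less_imp_le intro!: Max_eqI Min_eqI)
        then show "Max (I j) < Min (I (Suc j))"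
          by (simp add: s_def)
      qed
      moreover have False
        if "infinite A" and z: "subsequence_with_indices_in (UNIV - (\<Union>i\<in>A. I i)) z x"
          and yz: "signed_perm_equivalent scl y z" for A z
      proof -
        obtain t where t: "strict_mono t" "range t \<subseteq> UNIV - (\<Union>i\<in>A. I i)" "z = x \<circ> t"
          using z by (auto simp: subsequence_with_indices_in_def)
        obtain \<epsilon> \<sigma> K where \<epsilon>: "\<And>n. \<epsilon> n \<in> {- 1, 1}" and \<sigma>: "bij \<sigma>"
            and K: "\<And>n. family_equiv K n y (\<lambda>n. scl (\<epsilon> (\<sigma> n)) (z (\<sigma> n)))"
          using yz unfolding signed_perm_equivalent_def perm_equivalent_def seq_equivalent_iff by blast
        \<comment> \<open>An infinite \<open>A\<close> contains some \<open>j\<close> above the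
          equivalence constant \<open>K\<close>. The copy \<open>z\<close> avoids
          \<open>I j\<close>, which was built to meet all copies with constant
          \<open>Suc j\<close>.\<close>
        obtain j where "j \<in> A" "nat \<lceil>K\<rceil> < j"
          using \<open>infinite A\<close> by (meson infinite_nat_iff_unbounded)
        have "K \<le> real (Suc j)"
          using \<open>nat \<lceil>K\<rceil> < j\<close> by linarith
        then have "family_equiv (real (Suc j)) n y (\<lambda>i. scl ((\<epsilon> \<circ> \<sigma>) i) (x ((t \<circ> \<sigma>) i)))" for n
          using family_equiv_mono[OF K] by (simp add: t(3))
        moreover have "inj (t \<circ> \<sigma>)"
          using strict_mono_imp_inj_on[OF t(1)] \<sigma> by (simp add: inj_compose bij_is_inj)
        moreover have "(t \<circ> \<sigma>) i \<notin> {s j..m j (s j)}" for i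
          using t(2) \<open>j \<in> A\<close> unfolding I_def comp_apply by blast
        moreover have "(\<epsilon> \<circ> \<sigma>) i \<in> {- 1, 1}" for i
          using \<epsilon> by simp
        ultimately show False
          using m(2)[of j "s j"] unfolding hits_def by blast
      qed
      ultimately show ?thesis
        by blast
    qed
    then show ?thesis
      using d(1) by (intro exI[of _ x]) (auto simp: subsequence_of_def x_def)
  qed
qed

end
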